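(* Let $\boldsymbol\pi=(\boldsymbol\pi_s)_{s\in\mathbb N}$ be a sequence where each $\boldsymbol\pi_s$ is a permutation of $\{0,\dots,2^{m_s}-1\}^d$ acting coordinatewise, i.e. $\boldsymbol\pi_s(\mathbf m)=(\pi^1_s(m^1),\dots,\pi^d_s(m^d))$ for some permutations $\pi^j_s$ of $\{0,\dots,2^{m_s}-1\}$. Let $F^{\boldsymbol\pi}=\bigcap_{s\ge1}F^{\boldsymbol\pi}_s$ be as in the context. Then $F^{\boldsymbol\pi}$ is an $M$-set for the $d$-dimensional Walsh system with respect to convergence by rectangles, by cubes, and repeated convergence for every order of iterated summation; moreover the $d$-fold Walsh series $\sum_{\mathbf n}\widehat{\tau^{\boldsymbol\pi}}_{\mathbf n}W_{\mathbf n}$ generating the quasimeasure $\tau^{\boldsymbol\pi}:=\tau_{F^{\boldsymbol\pi}}$ is a null-series realizing the $M$-set $F^{\boldsymbol\pi}$.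
   Context: Fix an integer $d\ge 2$. $\mathbb G$ is the dyadic group: sequences $g=(g_k)_{k\ge0}$, $g_k\in\{0,1\}$, coordinatewise addition mod 2 ($\oplus$), product topology; $\mathbb G^d$ its $d$-th power, $\mu$ the normalized Haar measure. For $n\in\mathbb N_0$, $n=\sum_kn_k2^k$ with $n_k\in\{0,1\}$. Dyadic interval of rank $k$: $\Delta^{(k)}_m=\{g: g_t=m_{k-1-t},\ 0\le t<k\}$, $0\le m<2^k$; dyadic cube $\Delta^{(k)}_{\mathbf m}=\prod_{l}\Delta^{(k)}_{m^l}$, $\mathbf m\in\{0,\dots,2^k-1\}^d$. Vector order is coordinatewise, $\mathbf 1=(1,\dots,1)$. Walsh functions $W_n(g)=\prod_k(-1)^{g_kn_k}$, $W_{\mathbf n}(\mathbf g)=\prod_lW_{n^l}(g^l)$; for $\mathbf n,\mathbf m<2^k\mathbf 1$, $W^{(k)}_{\mathbf n\mathbf m}$ denotes the constant value of $W_{\mathbf n}$ on $\Delta^{(k)}_{\mathbf m}$; $R_{k\mathbf 1}:=W_{2^k\mathbf 1}$. Series $\sum_{\mathbf n\in\mathbb N_0^d}a_{\mathbf n}W_{\mathbf n}$, partial sums $S_{\mathbf N}=\sum_{\mathbf n<\mathbf N}a_{\mathbf n}W_{\mathbf n}$. Convergence by rectangles: $S_{\mathbf N}(\mathbf g)\to S$ as $\min_jN^j\to\infty$; by cubes: $S_{N\mathbf 1}(\mathbf g)\to S$; repeated convergence for a permutation $(j_1,\dots,j_d)$: the iterated sum $\sum_{n^{j_1}}(\sum_{n^{j_2}}(\cdots\sum_{n^{j_d}}a_{\mathbf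 n}W_{\mathbf n}(\mathbf g)))$ converges to $S$. $A$ is an $M$-set if some series with not all coefficients zero converges to $0$ at every point outside $A$ (a null-series realizing $A$). Quasimeasure: $\tau$ on dyadic cubes with $\tau(\Delta^{(k)}_{\mathbf m})=\sum_{\boldsymbol\sigma\in\{0,1\}^d}\tau(\Delta^{(k+1)}_{2\mathbf m+\boldsymbol\sigma})$; coefficients $\widehat\tau_{\mathbf n}=\sum_{\mathbf m<2^k\mathbf 1}W^{(k)}_{\mathbf n\mathbf m}\tau(\Delta^{(k)}_{\mathbf m})$ ($\mathbf n<2^k\mathbf 1$); $\sum\widehat\tau_{\mathbf n}W_{\mathbf n}$ is the series generating $\tau$. For nonempty closed $E$, $\tau_E$ is the unique nonnegative quasimeasure with $\tau_E(\mathbb G^d)=1$, $\tau_E(\Delta)=0$ iff $\Delta\cap E=\emptyset$, and which splits the value of a cube meeting $E$ equally among those of its $2^d$ children that meet $E$. Let $m_1=0$, $m_{s+1}=2(2m_s+1)$. For $s\in\mathbb N$, $F^{\boldsymbol\pi}_s=\bigcup_{\mathbf m<2^{m_s}\mathbf 1}\bigcup_{\mathbf m'<2^{m_s}\mathbf 1}\{\mathbf g\in\Delta^{(2m_s)}_{2^{m_s}\mathbf m+\mathbf m'}: R_{2m_s\mathbf 1}(\mathbf g)=W^{(m_s)}_{\boldsymbol\pi_s(\mathbf m)\,\mathbf m'}\}$ and $F^{\boldsymbol\pi}=\bigcap_sF^{\boldsymbol\pi}_s$. *)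

theory Defs
  imports Complex_Main
begin

text \<open>Points of the dyadic group G are bit sequences nat => bool; points of G^d are
  functions from a finite index type 'd (with CARD('d) = d) into G.
  Multi-indices are functions 'd => nat.\<close>

type_synonym 'd point = "'d \<Rightarrow> nat \<Rightarrow> bool"
type_synonym 'd idx = "'d \<Rightarrow> nat"

text \<open>One-dimensional Walsh function W_n(g) = prod_k (-1)^(g_k n_k); only k < n matter.\<close>
definition walsh1 :: "nat \<Rightarrow> (nat \<Rightarrow> bool) \<Rightarrow> real" where
  "walsh1 n x = (\<Prod>k<n. if bit n k \<and> x k then -1 else 1)"

definition walsh :: "'d::finite idx \<Rightarrow> 'd point \<Rightarrow> real" where
  "walsh n g = (\<Prod>l\<in>UNIV. walsh1 (n l) (g l))"

definition dint :: "nat \<Rightarrow> nat \<Rightarrow> (nat \<Rightarrow> bool) set" where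
  "dint k m = {x. \<forall>t<k. x t = bit m (k - 1 - t)}"

definition dcube :: "nat \<Rightarrow> 'd idx \<Rightarrow> 'd point set" where
  "dcube k m = {g. \<forall>l. g l \<in> dint k (m l)}"

text \<open>W^(k)_{n m}: the constant value of W_n on the cube of rank k with index m
  (for n, m < 2^k 1), computed at the point of the cube whose coordinates vanish beyond rank k.\<close>
definition wconst :: "nat \<Rightarrow> 'd::finite idx \<Rightarrow> 'd idx \<Rightarrow> real" where
  "wconst k n m = walsh n (\<lambda>l t. t < k \<and> bit (m l) (k - 1 - t))"

definition rad :: "nat \<Rightarrow> 'd::finite point \<Rightarrow> real" where
  "rad k g = walsh (\<lambda>_. 2 ^ k) g"

definition psum :: "('d::finite idx \<Rightarrow> real) \<Rightarrow> 'd idx \<Rightarrow> 'd point \<Rightarrow> real" where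
  "psum a N g = (\<Sum>n\<in>{n. \<forall>l. n l < N l}. a n * walsh n g)"

definition conv_rect :: "('d::finite idx \<Rightarrow> real) \<Rightarrow> 'd point \<Rightarrow> real \<Rightarrow> bool" where
  "conv_rect a g S \<longleftrightarrow>
     (\<forall>e>0. \<exists>M. \<forall>N. (\<forall>l. M \<le> N l) \<longrightarrow> \<bar>psum a N g - S\<bar> < e)"

definition conv_cube :: "('d::finite idx \<Rightarrow> real) \<Rightarrow> 'd point \<Rightarrow> real \<Rightarrow> bool" where
  "conv_cube a g S \<longleftrightarrow> (\<lambda>N. psum a (\<lambda>_. N) g) \<longlonglongrightarrow> S"

text \<open>Repeated convergence for the order of summation given by the list js
  (first element = outermost summation index). The multi-index n collects the
  already fixed outer indices.\<close>
fun rep_conv :: "('d::finite idx \<Rightarrow> real) \<Rightarrow> 'd point \<Rightarrow> 'd list \<Rightarrow> 'd idx \<Rightarrow> real \<Rightarrow> bool" where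
  "rep_conv a g [] n S = (S = a n * walsh n g)"
| "rep_conv a g (j # js) n S =
     (\<exists>f. (\<forall>k. rep_conv a g js (n(j := k)) (f k)) \<and> f sums S)"

definition conv_rep :: "'d list \<Rightarrow> ('d::finite idx \<Rightarrow> real) \<Rightarrow> 'd point \<Rightarrow> real \<Rightarrow> bool" where
  "conv_rep js a g S = rep_conv a g js (\<lambda>_. 0) S"

definition null_series ::
  "(('d::finite idx \<Rightarrow> real) \<Rightarrow> 'd point \<Rightarrow> real \<Rightarrow> bool) \<Rightarrow> ('d idx \<Rightarrow> real) \<Rightarrow> 'd point set \<Rightarrow> bool" where
  "null_series conv a A \<longleftrightarrow> (\<exists>n. a n \<noteq> 0) \<and> (\<forall>g. g \<notin> A \<longrightarrow> conv a g 0)"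

definition M_set ::
  "(('d::finite idx \<Rightarrow> real) \<Rightarrow> 'd point \<Rightarrow> real \<Rightarrow> bool) \<Rightarrow> 'd point set \<Rightarrow> bool" where
  "M_set conv A \<longleftrightarrow> (\<exists>a. null_series conv a A)"

text \<open>The quasimeasure tau_E: value 1 on G^d, and the value of a cube is split equally
  among those of its 2^d children that meet E (children missing E get 0).
  Indices outside the range m < 2^k 1 get value 0.\<close>
fun tauE :: "'d::finite point set \<Rightarrow> nat \<Rightarrow> 'd idx \<Rightarrow> real" where
  "tauE E 0 m = (if (\<forall>l. m l = 0) then 1 else 0)"
| "tauE E (Suc k) m =
     (if (\<forall>l. m l < 2 ^ Suc k) \<and> dcube (Suc k) m \<inter> E \<noteq> {}
      then tauE E k (\<lambda>l. m l div 2) /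
           real (card {c. (\<forall>l. c l div 2 = m l div 2) \<and> dcube (Suc k) c \<inter> E \<noteq> {}})
      else 0)"

definition qcoeff :: "(nat \<Rightarrow> 'd::finite idx \<Rightarrow> real) \<Rightarrow> 'd idx \<Rightarrow> real" where
  "qcoeff tau n = (let k = (LEAST k. \<forall>l. n l < 2 ^ k) in
     (\<Sum>m\<in>{m. \<forall>l. m l < 2 ^ k}. wconst k n m * tau k m))"

text \<open>m_1 = 0, m_{s+1} = 2(2 m_s + 1); indexing starts at s = 1 (mseq 0 is unused).\<close>
fun mseq :: "nat \<Rightarrow> nat" where
  "mseq 0 = 0"
| "mseq (Suc 0) = 0"
| "mseq (Suc (Suc s)) = 2 * (2 * mseq (Suc s) + 1)"

text \<open>pi_s(m) = (p s l (m l))_l, coordinatewise.\<close>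
definition Fs :: "(nat \<Rightarrow> 'd::finite \<Rightarrow> nat \<Rightarrow> nat) \<Rightarrow> nat \<Rightarrow> 'd point set" where
  "Fs p s = (let M = mseq s in
     {g. \<exists>m m'. (\<forall>l. m l < 2 ^ M \<and> m' l < 2 ^ M) \<and>
          g \<in> dcube (2 * M) (\<lambda>l. 2 ^ M * m l + m' l) \<and>
          rad (2 * M) g = wconst M (\<lambda>l. p s l (m l)) m'})"

definition Fpi :: "(nat \<Rightarrow> 'd::finite \<Rightarrow> nat \<Rightarrow> nat) \<Rightarrow> 'd point set" where
  "Fpi p = (\<Inter>s\<in>{1..}. Fs p s)"

end

theory Submission
  imports Defs "HOL-Library.FuncSet" "HOL-Library.Cardinality"
begin

text \<open>
  With \<open>M = m\<^sub>s\<close>, the s-th constraint reads \<open>\<chi>\<^sub>s(g) = 1\<close>, where \<open>\<chi>\<^sub>s\<close> takes the values 1 and -1,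
  depends only on the first \<open>2M + 1\<close> bits, and on each dyadic cube \<open>a\<close> of rank \<open>M\<close> is the single
  Walsh function with frequency \<open>2^(2M) + 2^M \<pi>\<^sub>s(a)\<close>. The quasimeasure therefore has at rank
  \<open>k\<close> the Riesz product of all \<open>1 + \<chi>\<^sub>s\<close> with \<open>2m\<^sub>s < k\<close> as its density, and the s-th factor only
  creates frequencies in the diagonal block \<open>[2^(2M), 2^(2M+1))^d\<close>.

  Let \<open>g\<close> violate constraint \<open>s\<^sub>0\<close>. Complete blocks add up to a Riesz product, which vanishes at \<open>g\<close>
  after stage \<open>s\<^sub>0\<close>. At most one block is cut by a rectangle \<open>N\<close>. As \<open>\<pi>\<^sub>s\<close> acts injectively on
  each coordinate, its partial sum is a sum over cubes \<open>a\<close> of products of one-dimensional kernels, and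
  in each coordinate only two values contribute: that of \<open>g\<close>, and the one whose frequencies are cut.
  The density vanishes near \<open>g\<close>, so some coordinate of \<open>a\<close> differs from \<open>g\<close> within the first
  \<open>k = 2m\<^sub>s\<^sub>0 + 1\<close> bits; there the kernel is a Dirichlet kernel bounded by \<open>2^k\<close>, divided by \<open>2^M\<close>.
  Since the density is at most \<open>2^s\<close>, the partial sum tends to 0.

  In repeated summation the inner sums are finite, because the blocks are diagonal; hence the outer
  partial sums are rectangular partial sums.
\<close>

section \<open>Binary digits and splitting of index ranges\<close>

lemma bit_less_pow:
  fixes n :: nat
  assumes "bit n k" "n < 2 ^ K"
  shows "k < K"
  using assms by (metis bit_take_bit_iff take_bit_nat_eq_self)

lemma bit_pow_add:
  fixes v :: nat
  assumes "v < 2 ^ k"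
  shows "bit (2 ^ k * c + v) i = (if i < k then bit v i else bit c (i - k))"
proof (cases "i < k")
  case True
  then obtain j where k: "k = i + Suc j"
    by (metis less_iff_Suc_add add_Suc_right)
  have "(2 ^ k * c + v) div 2 ^ i = 2 * (2 ^ j * c) + v div 2 ^ i"
    using div_mult_self2[of "2 ^ i" v "2 * (2 ^ j * c)"]
    by (simp add: k power_add ac_simps)
  then show ?thesis
    using True by (simp add: bit_iff_odd)
next
  case False
  then obtain j where i: "i = k + j"
    by (metis add_diff_inverse_nat)
  have "(2 ^ k * c + v) div 2 ^ i = c div 2 ^ j"
    using assms by (simp add: i power_add div_mult2_eq)
  then show ?thesis
    using False by (simp add: bit_iff_odd i)
qed

lemma xor_less_pow:
  fixes n q :: nat
  assumes "n < 2 ^ K" "q < 2 ^ K"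
  shows "xor n q < 2 ^ K"
  using assms by (metis take_bit_nat_eq_self take_bit_nat_eq_self_iff take_bit_xor)

lemma prod_lessThan_add:
  fixes f :: "nat \<Rightarrow> 'a::comm_monoid_mult"
  shows "(\<Prod>i<k + K. f i) = (\<Prod>i<k. f i) * (\<Prod>i<K. f (i + k))"
  by (induction K) (simp_all add: ac_simps)

lemma sum_lessThan_add:
  fixes f :: "nat \<Rightarrow> 'a::comm_monoid_add"
  shows "(\<Sum>i<k + K. f i) = (\<Sum>i<k. f i) + (\<Sum>i<K. f (k + i))"
  by (induction K) (simp_all add: ac_simps)

lemma sum_lessThan_double:
  fixes f :: "nat \<Rightarrow> 'a::comm_monoid_add"
  shows "(\<Sum>r<2 * n. f r) = (\<Sum>r<n. f (2 * r) + f (2 * r + 1))"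
  by (induction n) (simp_all add: ac_simps)

lemma prod_neutral_atLeast:
  fixes f :: "nat \<Rightarrow> 'a::comm_monoid_mult"
  assumes "\<And>k. K \<le> k \<Longrightarrow> f k = 1" "K \<le> L"
  shows "(\<Prod>k<L. f k) = (\<Prod>k<K. f k)"
  by (rule prod.mono_neutral_right) (use assms in auto)

subsection \<open>One-dimensional Walsh functions\<close>

text \<open>Digits of \<open>n\<close> from position \<open>K\<close> on vanish, so two frequencies
  can share one range of factors.\<close>

lemma walsh1_eq:
  assumes "n < 2 ^ K"
  shows "walsh1 n x = (\<Prod>k<K. if bit n k \<and> x k then -1 else 1)"
proof -
  let ?f = "\<lambda>k. if bit n k \<and> x k then -1 else (1::real)"
  have f: "?f k = 1" if "L \<le> k" "n < 2 ^ L" for k L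
    using that bit_less_pow[of n k L] by auto
  have "(\<Prod>k<max n K. ?f k) = (\<Prod>k<n. ?f k)"
    by (rule prod_neutral_atLeast) (use f[of n] less_exp[of n] in auto)
  moreover have "(\<Prod>k<max n K. ?f k) = (\<Prod>k<K. ?f k)"
    by (rule prod_neutral_atLeast) (use f[of K] assms in auto)
  ultimately show ?thesis
    by (simp add: walsh1_def)
qed

lemma walsh1_cong:
  assumes "n < 2 ^ K" "\<And>t. t < K \<Longrightarrow> x t = y t"
  shows "walsh1 n x = walsh1 n y"
  unfolding walsh1_eq[OF assms(1)] by (rule prod.cong) (use assms in auto)

lemma walsh1_0 [simp]: "walsh1 0 x = 1"
  by (simp add: walsh1_def)

lemma walsh1_1 [simp]: "walsh1 (Suc 0) x = (if x 0 then -1 else 1)"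
  by (simp add: walsh1_def bit_0)

lemma walsh1_cases: "walsh1 n x = 1 \<or> walsh1 n x = -1"
proof -
  have "\<bar>walsh1 n x\<bar> = 1"
    by (auto simp: walsh1_def abs_prod intro!: prod.neutral)
  then show ?thesis by linarith
qed

lemma abs_walsh1 [simp]: "\<bar>walsh1 n x\<bar> = 1"
  using walsh1_cases[of n x] by auto

text \<open>\<open>\<lambda>t. x t \<noteq> y t\<close> is the group sum of \<open>x\<close> and
  \<open>y\<close>.\<close>

lemma walsh1_mult_point: "walsh1 n x * walsh1 n y = walsh1 n (\<lambda>t. x t \<noteq> y t)"
  unfolding walsh1_def prod.distrib[symmetric] by (rule prod.cong) auto

lemma walsh1_mult_index:
  "walsh1 n x * walsh1 q x = walsh1 (xor n q) x"
proof -
  define K where "K = max n q"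
  have K: "n < 2 ^ K" "q < 2 ^ K"
    using less_le_trans[OF less_exp[of n] power_increasing[of n K 2]]
      less_le_trans[OF less_exp[of q] power_increasing[of q K 2]] by (auto simp: K_def)
  show ?thesis
    unfolding walsh1_eq[OF K(1)] walsh1_eq[OF K(2)] walsh1_eq[OF xor_less_pow[OF K]]
      prod.distrib[symmetric]
    by (rule prod.cong) (auto simp: bit_xor_iff)
qed

lemma walsh1_pow_add:
  assumes "v < 2 ^ k"
  shows "walsh1 (2 ^ k * c + v) x = walsh1 v x * walsh1 c (\<lambda>t. x (t + k))"
proof -
  have "2 ^ k * c + v < 2 ^ k * (c + 1)"
    using assms by simp
  also have "\<dots> \<le> 2 ^ k * 2 ^ c"
    by (intro mult_left_mono) (auto simp: Suc_leI)
  finally have "2 ^ k * c + v < 2 ^ (k + c)"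
    by (simp add: power_add)
  then have "walsh1 (2 ^ k * c + v) x =
      (\<Prod>i<k + c. if bit (2 ^ k * c + v) i \<and> x i then -1 else 1)"
    by (rule walsh1_eq)
  also have "\<dots> = (\<Prod>i<k. if bit v i \<and> x i then -1 else 1)
      * (\<Prod>i<c. if bit c i \<and> x (i + k) then -1 else 1)"
    unfolding prod_lessThan_add
    by (intro arg_cong2[where f = "(*)"] prod.cong) (auto simp: bit_pow_add[OF assms])
  also have "\<dots> = walsh1 v x * walsh1 c (\<lambda>t. x (t + k))"
    using walsh1_eq[OF assms] by (simp add: walsh1_def)
  finally show ?thesis .
qed

lemma walsh1_pow_mult: "walsh1 (2 ^ k * c) x = walsh1 c (\<lambda>t. x (t + k))"
  using walsh1_pow_add[of 0 k c x] by simp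

lemma walsh1_div_mod:
  "walsh1 n x = walsh1 (n mod 2 ^ k) x * walsh1 (n div 2 ^ k) (\<lambda>t. x (t + k))"
  using walsh1_pow_add[of "n mod 2 ^ k" k "n div 2 ^ k" x] by simp

section \<open>Dirichlet kernels\<close>

definition dirichlet :: "nat \<Rightarrow> (nat \<Rightarrow> bool) \<Rightarrow> real" where
  "dirichlet b x = (\<Sum>v<b. walsh1 v x)"

text \<open>Adding less than \<open>2 ^ k\<close> to \<open>2 ^ k * c\<close> causes no carries, so
  \<open>walsh1 (2 ^ k * c) x\<close> factors out of the second block.\<close>

lemma dirichlet_pow_mult_add:
  assumes "r \<le> 2 ^ k"
  shows "dirichlet (2 ^ k * c + r) x =
    dirichlet (2 ^ k * c) x + walsh1 (2 ^ k * c) x * dirichlet r x"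
  unfolding dirichlet_def sum_lessThan_add sum_distrib_left
  by (intro arg_cong2[where f = "(+)"] sum.cong refl)
     (use assms in \<open>auto simp: walsh1_pow_add walsh1_pow_mult\<close>)

text \<open>Doubling the number of terms multiplies the kernel by
  \<open>1 + walsh1 (2 ^ k) x\<close>, which is 2 or 0 according to bit \<open>k\<close> of
  \<open>x\<close>.\<close>

lemma dirichlet_pow: "dirichlet (2 ^ k) x = (if \<forall>i<k. \<not> x i then 2 ^ k else 0)"
proof (induction k)
  case 0
  then show ?case by (simp add: dirichlet_def)
next
  case (Suc k)
  have "dirichlet (2 ^ Suc k) x = dirichlet (2 ^ k * 1 + 2 ^ k) x"
    by (simp add: mult_2)
  also have "\<dots> = dirichlet (2 ^ k) x * (1 + walsh1 (2 ^ k * 1) x)"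
    unfolding dirichlet_pow_mult_add[OF order_refl] by (simp add: algebra_simps)
  finally show ?case
    unfolding walsh1_pow_mult using Suc by (auto simp: less_Suc_eq)
qed

lemma abs_dirichlet_le: "\<bar>dirichlet b x\<bar> \<le> real b"
  unfolding dirichlet_def by (rule order_trans[OF sum_abs]) simp

text \<open>Complete runs of \<open>2 ^ k\<close> frequencies cancel because one of the first
  \<open>k\<close> bits of \<open>x\<close> is set; only the last \<open>b mod 2 ^ k\<close> terms
  remain.\<close>

lemma abs_dirichlet_le_pow:
  assumes "x i" "i < k"
  shows "\<bar>dirichlet b x\<bar> \<le> 2 ^ k"
proof -
  have zero: "dirichlet (2 ^ k) x = 0"
    using assms by (auto simp: dirichlet_pow)
  have multiple: "dirichlet (2 ^ k * c) x = 0" for c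
  proof (induction c)
    case 0
    then show ?case by (simp add: dirichlet_def)
  next
    case (Suc c)
    then show ?case
      using dirichlet_pow_mult_add[of "2 ^ k" k c x] zero by (simp add: add.commute)
  qed
  have r: "b mod 2 ^ k < 2 ^ k"
    by simp
  have "dirichlet b x = walsh1 (2 ^ k * (b div 2 ^ k)) x * dirichlet (b mod 2 ^ k) x"
    using dirichlet_pow_mult_add[of "b mod 2 ^ k" k "b div 2 ^ k" x] multiple r by simp
  then have "\<bar>dirichlet b x\<bar> \<le> real (b mod 2 ^ k)"
    using abs_dirichlet_le[of "b mod 2 ^ k" x] by (simp add: abs_mult)
  also have "\<dots> \<le> real (2 ^ k)"
    using r by (intro of_nat_mono less_imp_le)
  finally show ?thesis by simp
qed

subsection \<open>Dyadic intervals\<close>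

text \<open>The corner of \<open>dint k m\<close>: the digits of \<open>m\<close>, most significant
  first, followed by zeros. \<open>idx1\<close> inverts this for \<open>m < 2 ^ k\<close>.\<close>

definition pt1 :: "nat \<Rightarrow> nat \<Rightarrow> nat \<Rightarrow> bool" where
  "pt1 k m = (\<lambda>t. t < k \<and> bit m (k - 1 - t))"

fun idx1 :: "nat \<Rightarrow> (nat \<Rightarrow> bool) \<Rightarrow> nat" where
  "idx1 0 y = 0"
| "idx1 (Suc k) y = 2 * idx1 k y + of_bool (y k)"

lemma idx1_less: "idx1 k y < 2 ^ k"
  by (induction k) auto

lemma idx1_cong: "(\<And>t. t < k \<Longrightarrow> x t = y t) \<Longrightarrow> idx1 k x = idx1 k y"
  by (induction k) auto

lemma pt1_idx1: "pt1 k (idx1 k y) t \<longleftrightarrow> t < k \<and> y t"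
proof (induction k)
  case 0
  then show ?case by (simp add: pt1_def)
next
  case (Suc k)
  show ?case
  proof (cases "t < k")
    case True
    then have "k - t = Suc (k - 1 - t)" by simp
    then show ?thesis
      using Suc True by (simp add: pt1_def bit_Suc)
  next
    case False
    then show ?thesis by (auto simp: pt1_def less_Suc_eq bit_0)
  qed
qed

lemma idx1_pt1: "m < 2 ^ k \<Longrightarrow> idx1 k (pt1 k m) = m"
proof (induction k arbitrary: m)
  case 0
  then show ?case by simp
next
  case (Suc k)
  have "pt1 (Suc k) m t = pt1 k (m div 2) t" if "t < k" for t
  proof -
    have "k - t = Suc (k - 1 - t)" using that by simp
    then show ?thesis using that by (simp add: pt1_def bit_Suc)
  qed
  then have "idx1 k (pt1 (Suc k) m) = idx1 k (pt1 k (m div 2))"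
    by (rule idx1_cong)
  also have "\<dots> = m div 2"
    using Suc by auto
  finally show ?case
    by (simp add: pt1_def bit_0)
qed

lemma pt1_eq_iff_idx1:
  assumes "a < 2 ^ k"
  shows "(\<forall>i<k. pt1 k a i = y i) \<longleftrightarrow> a = idx1 k y"
  using assms idx1_cong[of k "pt1 k a" y] idx1_pt1[of a k] by (auto simp: pt1_idx1)

lemma pt1_pow_add:
  assumes "r < 2 ^ j"
  shows "pt1 (i + j) (2 ^ j * a + r) t = (if t < i then pt1 i a t else pt1 j r (t - i))"
proof (cases "t < i")
  case True
  then have "\<not> i + j - 1 - t < j" "i + j - 1 - t - j = i - 1 - t" by auto
  then show ?thesis using True by (simp add: pt1_def bit_pow_add[OF assms])
next
  case False
  then have "t < i + j \<Longrightarrow> i + j - 1 - t < j" "i + j - 1 - t = j - 1 - (t - i)" by auto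
  then show ?thesis using False
    by (auto simp: pt1_def bit_pow_add[OF assms] simp flip: One_nat_def)
qed

lemma pt1_div: "t < i \<Longrightarrow> pt1 (i + j) m t = pt1 i (m div 2 ^ j) t"
  using pt1_pow_add[of "m mod 2 ^ j" j i "m div 2 ^ j" t] by simp

lemma walsh1_pt1_pow_add:
  assumes "r < 2 ^ j"
  shows "walsh1 n (pt1 (i + j) (2 ^ j * a + r)) =
    walsh1 (n mod 2 ^ i) (pt1 i a) * walsh1 (n div 2 ^ i) (pt1 j r)"
proof -
  have "walsh1 (n mod 2 ^ i) (pt1 (i + j) (2 ^ j * a + r)) = walsh1 (n mod 2 ^ i) (pt1 i a)"
    by (rule walsh1_cong[of _ i]) (auto simp: pt1_pow_add[OF assms])
  moreover have "(\<lambda>t. pt1 (i + j) (2 ^ j * a + r) (t + i)) = pt1 j r"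
    by (auto simp: pt1_pow_add[OF assms])
  ultimately show ?thesis
    unfolding walsh1_div_mod[of n _ i] by simp
qed

text \<open>The last bit of the point pairs with the leading digit \<open>h\<close> of
  \<open>n\<close>. If \<open>h = 1\<close> siblings cancel; if \<open>h = 0\<close> they double the
  sum for \<open>n mod 2 ^ j\<close>.\<close>

lemma sum_walsh1_pt1:
  "n < 2 ^ j \<Longrightarrow> (\<Sum>r<2 ^ j. walsh1 n (pt1 j r)) = (if n = 0 then 2 ^ j else 0)"
proof (induction j arbitrary: n)
  case 0
  then show ?case by simp
next
  case (Suc j)
  define h where "h = n div 2 ^ j"
  have "h < 2"
    unfolding h_def using Suc.prems by (simp add: less_mult_imp_div_less)
  then have h: "h = 0 \<or> h = 1" by auto
  have split: "walsh1 n (pt1 (Suc j) (2 * a + r)) =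
      walsh1 (n mod 2 ^ j) (pt1 j a) * walsh1 h (pt1 1 r)" if "r < 2" for a r
    using walsh1_pt1_pow_add[of r 1 n j a] that by (simp add: h_def)
  have "(\<Sum>r<2 ^ Suc j. walsh1 n (pt1 (Suc j) r)) =
      (\<Sum>a<2 ^ j. walsh1 (n mod 2 ^ j) (pt1 j a) * (walsh1 h (pt1 1 0) + walsh1 h (pt1 1 1)))"
    unfolding power_Suc sum_lessThan_double
    using split[of 0] split[of 1] by (simp add: distrib_left)
  also have "\<dots> = (if n mod 2 ^ j = 0 then 2 ^ j else 0)
      * (walsh1 h (pt1 1 0) + walsh1 h (pt1 1 1))"
    unfolding sum_distrib_right[symmetric] by (subst Suc.IH) simp_all
  also have "\<dots> = (if n = 0 then 2 ^ Suc j else 0)"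
  proof -
    have "n = 0 \<longleftrightarrow> n mod 2 ^ j = 0 \<and> h = 0"
      unfolding h_def by (metis div_0 mod_0 div_mult_mod_eq mult_0 add_0)
    moreover have "walsh1 h (pt1 1 0) + walsh1 h (pt1 1 1) = (if h = 0 then 2 else 0)"
      using h by (auto simp: pt1_def bit_0)
    ultimately show ?thesis by auto
  qed
  finally show ?case .
qed

text \<open>The indices \<open>m\<close> with \<open>m div 2 ^ j = a\<close> are the descendants of
  interval \<open>a\<close>. There the low \<open>i\<close> digits of \<open>n\<close> give a
  constant, and orthogonality in the remaining bits singles out
  \<open>n div 2 ^ i = q\<close>.\<close>

lemma sum_walsh1_mult_subcube:
  assumes "n < 2 ^ (i + j)" "q < 2 ^ j"
  shows "(\<Sum>m | m div 2 ^ j = a. walsh1 n (pt1 (i + j) m) * walsh1 (2 ^ i * q) (pt1 (i + j) m)) =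
    (if n div 2 ^ i = q then 2 ^ j * walsh1 (n mod 2 ^ i) (pt1 i a) else 0)"
proof -
  have img: "{m. m div 2 ^ j = a} = (\<lambda>r. 2 ^ j * a + r) ` {..<2 ^ j}"
  proof -
    have "m \<in> (\<lambda>r. 2 ^ j * a + r) ` {..<2 ^ j}" if "m div 2 ^ j = a" for m
      using that by (intro image_eqI[of _ _ "m mod 2 ^ j"]) auto
    then show ?thesis by auto
  qed
  have nq: "n div 2 ^ i < 2 ^ j"
    using assms(1) by (simp add: less_mult_imp_div_less power_add mult.commute)
  have "(\<Sum>m | m div 2 ^ j = a. walsh1 n (pt1 (i + j) m) * walsh1 (2 ^ i * q) (pt1 (i + j) m)) =
      (\<Sum>r<2 ^ j. walsh1 n (pt1 (i + j) (2 ^ j * a + r))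
        * walsh1 (2 ^ i * q) (pt1 (i + j) (2 ^ j * a + r)))"
    unfolding img by (subst sum.reindex) (auto simp: inj_on_def)
  also have "\<dots> = (\<Sum>r<2 ^ j. walsh1 (n mod 2 ^ i) (pt1 i a) * walsh1 (xor (n div 2 ^ i) q) (pt1 j r))"
    by (intro sum.cong refl)
       (simp add: walsh1_pt1_pow_add mult.assoc flip: walsh1_mult_index)
  also have "\<dots> = walsh1 (n mod 2 ^ i) (pt1 i a) * (if xor (n div 2 ^ i) q = 0 then 2 ^ j else 0)"
    unfolding sum_distrib_left[symmetric]
    by (subst sum_walsh1_pt1) (use xor_less_pow[OF nq assms(2)] in auto)
  also have "xor (n div 2 ^ i) q = 0 \<longleftrightarrow> n div 2 ^ i = q"
    by (metis bit.xor_cancel_left xor.right_neutral xor_self_eq xor.left_commute)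
  finally show ?thesis by simp
qed

section \<open>Sums over boxes and points of dyadic cubes\<close>

lemma box_eq_PiE: "{h. \<forall>l. h l \<in> B l} = PiE UNIV B"
  by (auto simp: PiE_UNIV_domain Pi_def)

lemma finite_box:
  fixes B :: "'d::finite \<Rightarrow> 'b set"
  assumes "\<And>l. finite (B l)"
  shows "finite {h. \<forall>l. h l \<in> B l}"
  unfolding box_eq_PiE using assms by (intro finite_PiE) auto

lemma sum_box_prod:
  fixes B :: "'d::finite \<Rightarrow> 'b set" and f :: "'d \<Rightarrow> 'b \<Rightarrow> real"
  assumes "\<And>l. finite (B l)"
  shows "(\<Sum>h | \<forall>l. h l \<in> B l. \<Prod>l\<in>UNIV. f l (h l)) = (\<Prod>l\<in>UNIV. \<Sum>y\<in>B l. f l y)"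
  unfolding box_eq_PiE using assms by (subst prod_sum_PiE) auto

lemma prod_sign:
  fixes f :: "'a \<Rightarrow> real"
  assumes "\<And>l. f l = 1 \<or> f l = -1"
  shows "prod f A = 1 \<or> prod f A = -1"
proof -
  have "\<bar>f l\<bar> = 1" for l
    using assms[of l] by auto
  then have "\<bar>prod f A\<bar> = 1"
    by (simp add: abs_prod)
  then show ?thesis by linarith
qed

definition pt :: "nat \<Rightarrow> 'd idx \<Rightarrow> 'd point" where
  "pt k m = (\<lambda>l. pt1 k (m l))"

lemma wconst_eq: "wconst k n m = walsh n (pt k m)"
  by (simp add: wconst_def pt_def pt1_def)

lemma mem_dcube: "g \<in> dcube k m \<longleftrightarrow> (\<forall>l. \<forall>t<k. g l t = pt k m l t)"
  by (auto simp: dcube_def dint_def pt_def pt1_def)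

lemma mem_dint_pow_add:
  assumes "a < 2 ^ k" "b < 2 ^ k"
  shows "y \<in> dint (k + k) (2 ^ k * a + b) \<longleftrightarrow> a = idx1 k y \<and> b = idx1 k (\<lambda>t. y (t + k))"
proof
  assume "y \<in> dint (k + k) (2 ^ k * a + b)"
  then have y: "y t = pt1 (k + k) (2 ^ k * a + b) t" if "t < k + k" for t
    using that by (auto simp: dint_def pt1_def)
  have "idx1 k y = idx1 k (pt1 k a)"
    by (rule idx1_cong) (simp add: y pt1_pow_add[OF assms(2)])
  moreover have "idx1 k (\<lambda>t. y (t + k)) = idx1 k (pt1 k b)"
    by (rule idx1_cong) (simp add: y pt1_pow_add[OF assms(2)])
  ultimately show "a = idx1 k y \<and> b = idx1 k (\<lambda>t. y (t + k))"
    using assms by (simp add: idx1_pt1)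
next
  assume ab: "a = idx1 k y \<and> b = idx1 k (\<lambda>t. y (t + k))"
  have "y t = pt1 (k + k) (2 ^ k * a + b) t" if "t < k + k" for t
    unfolding pt1_pow_add[OF assms(2)] using that ab by (auto simp: pt1_idx1)
  then show "y \<in> dint (k + k) (2 ^ k * a + b)"
    by (auto simp: dint_def pt1_def)
qed

subsection \<open>Constraints and the Riesz product\<close>

text \<open>Stages are counted from 0 here: stage \<open>s\<close> belongs to the set
  \<open>Fs p (Suc s)\<close>.\<close>

abbreviation M :: "nat \<Rightarrow> nat" where
  "M s \<equiv> mseq (Suc s)"

text \<open>Stage \<open>s\<close> reads \<open>2 * M s + 1\<close> bits, so every later stage
  \<open>t\<close> finds all of them among its first \<open>M t\<close> bits.\<close>

lemma M_less: "s < t \<Longrightarrow> 2 * M s + 1 \<le> M t"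
  by (induction t) (auto simp: less_Suc_eq)

lemma M_mono: "s \<le> t \<Longrightarrow> M s \<le> M t"
  using M_less[of s t] by (cases "s = t") auto

lemma M_inj: "M s = M t \<Longrightarrow> s = t"
  using M_less[of s t] M_less[of t s] by (cases s t rule: linorder_cases) auto

lemma M_ge: "2 * s \<le> M s"
  by (induction s) auto

lemma ex_less_pow_M:
  fixes n :: "'d::finite idx"
  shows "\<exists>s. \<forall>l. n l < 2 ^ (2 * M s)"
proof (intro exI allI)
  fix l
  define S where "S = (\<Sum>l\<in>UNIV. n l)"
  have "n l \<le> S"
    unfolding S_def by (rule member_le_sum) auto
  also have "S < 2 ^ S" by (rule less_exp)
  also have "\<dots> \<le> 2 ^ (2 * M S)"
    using M_ge[of S] by (intro power_increasing) auto
  finally show "n l < 2 ^ (2 * M (\<Sum>l\<in>UNIV. n l))"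
    by (simp add: S_def)
qed

locale riesz_set =
  fixes p :: "nat \<Rightarrow> 'd::finite \<Rightarrow> nat \<Rightarrow> nat"
  assumes bij: "\<And>s l. s \<ge> 1 \<Longrightarrow> bij_betw (p s l) {..<2 ^ mseq s} {..<2 ^ mseq s}"
begin

definition freq :: "nat \<Rightarrow> 'd \<Rightarrow> nat \<Rightarrow> nat" where
  "freq s l a = 2 ^ M s + p (Suc s) l a"

text \<open>The summand \<open>2 ^ M s\<close> of \<open>freq\<close> produces the Rademacher factor of rank \<open>2 * M s\<close>.\<close>

definition chi1 :: "nat \<Rightarrow> 'd \<Rightarrow> (nat \<Rightarrow> bool) \<Rightarrow> real" where
  "chi1 s l y = walsh1 (2 ^ M s * freq s l (idx1 (M s) y)) y"

definition chi :: "nat \<Rightarrow> 'd point \<Rightarrow> real" where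
  "chi s g = (\<Prod>l\<in>UNIV. chi1 s l (g l))"

definition riesz :: "nat \<Rightarrow> 'd point \<Rightarrow> real" where
  "riesz s g = (\<Prod>t<s. 1 + chi t g)"

lemma p_less: "a < 2 ^ M s \<Longrightarrow> p (Suc s) l a < 2 ^ M s"
  using bij[of "Suc s" l] by (auto simp: bij_betw_def)

lemma freq_less: "a < 2 ^ M s \<Longrightarrow> freq s l a < 2 ^ (M s + 1)"
  using p_less[of a s l] by (simp add: freq_def)

lemma freq_ge: "2 ^ M s \<le> freq s l a"
  by (simp add: freq_def)

lemma freq_inj:
  "a < 2 ^ M s \<Longrightarrow> b < 2 ^ M s \<Longrightarrow> freq s l a = freq s l b \<Longrightarrow> a = b"
  using bij[of "Suc s" l] by (auto simp: freq_def bij_betw_def dest: inj_onD)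

text \<open>The leading digit of \<open>freq\<close> acts on bit \<open>2 * M s\<close>, the digits
  of the permuted index on the \<open>M s\<close> bits before it.\<close>

lemma chi1_eq:
  "chi1 s l y = walsh1 (p (Suc s) l (idx1 (M s) y)) (\<lambda>t. y (t + M s)) * (if y (2 * M s) then -1 else 1)"
proof -
  have "chi1 s l y = walsh1 (2 ^ M s * 1 + p (Suc s) l (idx1 (M s) y)) (\<lambda>t. y (t + M s))"
    by (simp add: chi1_def freq_def walsh1_pow_mult)
  then show ?thesis
    unfolding walsh1_pow_add[OF p_less[OF idx1_less]] by (simp add: mult_2)
qed

lemma chi1_cong:
  assumes "\<And>t. t < 2 * M s + 1 \<Longrightarrow> x t = y t"
  shows "chi1 s l x = chi1 s l y"
proof -
  have i: "idx1 (M s) x = idx1 (M s) y"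
    by (rule idx1_cong) (simp add: assms)
  show ?thesis
    unfolding chi1_eq i using assms
    by (intro arg_cong2[where f = "(*)"] walsh1_cong[OF p_less[OF idx1_less]]) auto
qed

text \<open>Bit \<open>2 * M s\<close> enters only through the Rademacher factor.\<close>

lemma chi1_flip: "chi1 s l (y(2 * M s := \<not> y (2 * M s))) = - chi1 s l y"
proof -
  have i: "idx1 (M s) (y(2 * M s := \<not> y (2 * M s))) = idx1 (M s) y"
    by (rule idx1_cong) auto
  have "walsh1 (p (Suc s) l (idx1 (M s) y)) (\<lambda>t. (y(2 * M s := \<not> y (2 * M s))) (t + M s)) =
      walsh1 (p (Suc s) l (idx1 (M s) y)) (\<lambda>t. y (t + M s))"
    by (rule walsh1_cong[OF p_less[OF idx1_less]]) auto
  then show ?thesis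
    unfolding chi1_eq i by simp
qed

lemma chi_cong:
  assumes "\<And>l t. t < 2 * M s + 1 \<Longrightarrow> g l t = h l t"
  shows "chi s g = chi s h"
  unfolding chi_def using assms by (intro prod.cong chi1_cong) auto

lemma chi_flip: "chi s (g(l := (g l)(2 * M s := \<not> g l (2 * M s)))) = - chi s g"
  unfolding chi_def
  by (simp add: prod.remove[of UNIV l] chi1_flip)

lemma chi_sign: "chi s g = 1 \<or> chi s g = -1"
  unfolding chi_def by (rule prod_sign) (simp add: chi1_def walsh1_cases)

lemma riesz_cong:
  assumes "\<And>l t i. i < s \<Longrightarrow> t < 2 * M i + 1 \<Longrightarrow> g l t = h l t"
  shows "riesz s g = riesz s h"
  unfolding riesz_def
  by (intro prod.cong arg_cong2[where f = "(+)"] chi_cong refl assms) auto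

lemma riesz_Suc: "riesz (Suc s) g = riesz s g * (1 + chi s g)"
  by (simp add: riesz_def)

lemma riesz_nonneg: "0 \<le> riesz s g"
proof -
  have "0 \<le> 1 + chi t g" for t
    using chi_sign[of t g] by auto
  then show ?thesis
    by (simp add: riesz_def prod_nonneg)
qed

lemma riesz_le: "riesz s g \<le> 2 ^ s"
proof (induction s)
  case (Suc s)
  then show ?case
    using chi_sign[of s g] riesz_nonneg[of s g] by (auto simp: riesz_Suc)
qed (simp add: riesz_def)

text \<open>Telescoping of \<open>riesz (Suc t) g - riesz t g = riesz t g * chi t g\<close>; each
  summand carries one block of frequencies.\<close>

lemma riesz_expand: "riesz s g = 1 + (\<Sum>t<s. riesz t g * chi t g)"
  by (induction s) (simp_all add: riesz_Suc algebra_simps, simp add: riesz_def)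

text \<open>The cube condition forces \<open>m\<close> and \<open>m'\<close> to be the two
  successive groups of \<open>M s\<close> bits of \<open>g\<close>. What remains is an equation
  between two signs, that is, their product is 1.\<close>

lemma mem_Fs: "g \<in> Fs p (Suc s) \<longleftrightarrow> chi s g = 1"
proof -
  define a b where "a = (\<lambda>l. idx1 (M s) (g l))" and "b = (\<lambda>l. idx1 (M s) (\<lambda>t. g l (t + M s)))"
  define W where "W = wconst (M s) (\<lambda>l. p (Suc s) l (a l)) b"
  have "g \<in> dcube (2 * M s) (\<lambda>l. 2 ^ M s * m l + m' l) \<longleftrightarrow> m = a \<and> m' = b"
    if "\<forall>l. m l < 2 ^ M s \<and> m' l < 2 ^ M s" for m m'
    using that mem_dint_pow_add unfolding dcube_def a_def b_def mult_2
    by (auto simp: fun_eq_iff)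
  moreover have "\<forall>l. a l < 2 ^ M s \<and> b l < 2 ^ M s"
    by (simp add: a_def b_def idx1_less)
  ultimately have mem: "g \<in> Fs p (Suc s) \<longleftrightarrow> rad (2 * M s) g = W"
    unfolding Fs_def W_def Let_def by blast
  have "walsh1 (2 ^ (2 * M s)) (g l) = (if g l (2 * M s) then -1 else 1)" for l
    using walsh1_pow_mult[of "2 * M s" 1 "g l"] by simp
  then have rad: "rad (2 * M s) g = (\<Prod>l\<in>UNIV. if g l (2 * M s) then -1 else 1)"
    by (simp add: rad_def walsh_def)
  have "walsh1 (p (Suc s) l (a l)) (pt1 (M s) (b l)) =
      walsh1 (p (Suc s) l (a l)) (\<lambda>t. g l (t + M s))" for l
    unfolding a_def b_def by (rule walsh1_cong[OF p_less[OF idx1_less]]) (simp add: pt1_idx1)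
  then have W: "W = (\<Prod>l\<in>UNIV. walsh1 (p (Suc s) l (a l)) (\<lambda>t. g l (t + M s)))"
    by (simp add: W_def wconst_eq walsh_def pt_def)
  have chi: "chi s g = W * rad (2 * M s) g"
    unfolding chi_def chi1_eq W rad a_def by (rule prod.distrib)
  have "W = 1 \<or> W = -1"
    unfolding W by (rule prod_sign) (rule walsh1_cases)
  moreover have "rad (2 * M s) g = 1 \<or> rad (2 * M s) g = -1"
    unfolding rad by (rule prod_sign) auto
  ultimately show ?thesis
    unfolding mem chi by auto
qed

lemma mem_Fpi: "g \<in> Fpi p \<longleftrightarrow> (\<forall>s. chi s g = 1)"
proof -
  have "g \<in> Fpi p \<longleftrightarrow> (\<forall>s. g \<in> Fs p (Suc s))"
    unfolding Fpi_def by (auto, metis Suc_le_D One_nat_def)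
  then show ?thesis by (simp add: mem_Fs)
qed

text \<open>Stages with \<open>2 * M t < k\<close> are constant on the cube. Every other one can be
  met by flipping bit \<open>2 * M t\<close>, which is outside the first \<open>k\<close> bits and
  not read by earlier stages.\<close>

lemma dcube_meets_Fpi_iff:
  "dcube k m \<inter> Fpi p \<noteq> {} \<longleftrightarrow> (\<forall>t. 2 * M t < k \<longrightarrow> chi t (pt k m) = 1)"
proof
  assume "dcube k m \<inter> Fpi p \<noteq> {}"
  then obtain g where g: "g \<in> dcube k m" "g \<in> Fpi p" by blast
  have "chi t (pt k m) = chi t g" if "2 * M t < k" for t
    by (rule chi_cong) (use g(1) that in \<open>auto simp: mem_dcube\<close>)
  then show "\<forall>t. 2 * M t < k \<longrightarrow> chi t (pt k m) = 1"
    using g(2) by (simp add: mem_Fpi)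
next
  assume ok: "\<forall>t. 2 * M t < k \<longrightarrow> chi t (pt k m) = 1"
  \<comment> \<open>Bits at rank at least k are chosen one after the other: they are 0 except for one
    distinguished coordinate, whose bit at position 2 * M t is flipped if the t-th
    constraint would fail otherwise.\<close>
  define l0 :: 'd where "l0 = undefined"
  define H where "H = rec_nat (pt k m) (\<lambda>i h.
    if \<exists>t. 2 * M t = k + i \<and> chi t h \<noteq> 1 then h(l0 := (h l0)(k + i := \<not> h l0 (k + i))) else h)"
  have H0: "H 0 = pt k m"
    by (simp add: H_def)
  have HS: "H (Suc i) = (if \<exists>t. 2 * M t = k + i \<and> chi t (H i) \<noteq> 1
      then (H i)(l0 := (H i l0)(k + i := \<not> H i l0 (k + i))) else H i)" for i
    by (simp only: H_def old.nat.rec)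
  have H_agree: "H (i + j) l t = H i l t" if "t < k + i" for i j l t
    using that by (induction j) (auto simp: HS)
  \<comment> \<open>Bits below \<open>k + i\<close> are final in \<open>H i\<close>, so bit
    \<open>t\<close> is final in \<open>H (Suc t - k)\<close>; for \<open>t < k\<close> the
    truncated difference is 0 and the bit comes from the cube.\<close>
  define g where "g = (\<lambda>l t. H (Suc t - k) l t)"
  have g: "g l t = H i l t" if t: "t < k + i" for l t i
  proof -
    define j where "j = i - (Suc t - k)"
    have j: "i = (Suc t - k) + j"
      using t unfolding j_def by linarith
    show ?thesis
      unfolding g_def j by (rule H_agree[symmetric]) auto
  qed
  have chi_H: "chi t (H (Suc i)) = 1" if t: "2 * M t = k + i" for t i
  proof (cases "chi t (H i) = 1")
    case True
    have "t' = t" if "2 * M t' = k + i" for t'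
      using M_inj[of t' t] that t by simp
    then have "H (Suc i) = H i"
      using True unfolding HS by metis
    then show ?thesis using True by simp
  next
    case False
    then have "H (Suc i) = (H i)(l0 := (H i l0)(2 * M t := \<not> H i l0 (2 * M t)))"
      unfolding HS using t by metis
    then show ?thesis
      using False chi_sign[of t "H i"] by (simp add: chi_flip)
  qed
  have "chi t g = 1" for t
  proof (cases "2 * M t < k")
    case True
    have "chi t g = chi t (pt k m)"
      by (rule chi_cong) (use True g[of _ 0] H0 in auto)
    then show ?thesis using ok True by simp
  next
    case False
    then obtain i where i: "2 * M t = k + i"
      by (metis le_Suc_ex not_less)
    have "chi t g = chi t (H (Suc i))"
      by (rule chi_cong) (use i g[of _ "Suc i"] in auto)
    then show ?thesis using chi_H[OF i] by simp
  qed
  then have "g \<in> Fpi p" by (simp add: mem_Fpi)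
  moreover have "g \<in> dcube k m"
    using g[of _ 0] by (auto simp: mem_dcube H0)
  ultimately show "dcube k m \<inter> Fpi p \<noteq> {}" by blast
qed

subsection \<open>The quasimeasure\<close>

text \<open>The number of stages decided by the first \<open>k\<close> bits.\<close>

definition nconstr :: "nat \<Rightarrow> nat" where
  "nconstr k = (LEAST s. k \<le> 2 * M s)"

lemma less_nconstr_iff: "t < nconstr k \<longleftrightarrow> 2 * M t < k"
proof -
  have "k \<le> 2 * M (nconstr k)"
    unfolding nconstr_def by (rule LeastI[of _ k]) (use M_ge[of k] in simp)
  then have "2 * M t < k \<Longrightarrow> t < nconstr k"
    using M_mono[of "nconstr k" t] by (cases "t < nconstr k") auto
  moreover have "t < nconstr k \<Longrightarrow> 2 * M t < k"
    using not_less_Least[of t "\<lambda>s. k \<le> 2 * M s"] by (auto simp: nconstr_def)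
  ultimately show ?thesis by blast
qed

lemma nconstr_eqI: "(\<And>t. t < s \<longleftrightarrow> 2 * M t < k) \<Longrightarrow> nconstr k = s"
  using less_nconstr_iff[of _ k] by (metis linorder_neqE_nat less_irrefl)

lemma pt_Suc:
  assumes "t < k" "\<And>l. c l div 2 = m l div 2"
  shows "pt (Suc k) c l t = pt k (\<lambda>l. m l div 2) l t"
  using assms pt1_div[of t k 1 "c l"] by (simp add: pt_def)

text \<open>The two children differ in bit \<open>2 * M s\<close> only, whose flip changes the sign
  of \<open>chi1\<close>.\<close>

lemma sum_chi1_children:
  "(\<Sum>c | c div 2 = b. chi1 s l (pt1 (Suc (2 * M s)) c)) = 0"
proof -
  have set: "{c. c div 2 = b} = {2 * b, 2 * b + 1}" for b :: nat by auto
  let ?y = "pt1 (Suc (2 * M s)) (2 * b)"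
  have "pt1 (Suc (2 * M s)) (2 * b + 1) t = (?y(2 * M s := \<not> ?y (2 * M s))) t"
    if "t < 2 * M s + 1" for t
    using that pt1_pow_add[of 1 1 "2 * M s" b t] pt1_pow_add[of 0 1 "2 * M s" b t]
    by (auto simp: pt1_def bit_0)
  then have "chi1 s l (pt1 (Suc (2 * M s)) (2 * b + 1)) = - chi1 s l ?y"
    unfolding chi1_flip[symmetric] by (rule chi1_cong)
  then show ?thesis unfolding set by simp
qed

text \<open>All \<open>2 ^ CARD('d)\<close> children of a cube meeting the set meet it too, unless
  its rank is \<open>k = 2 * M s\<close>. There exactly half do, which matches the new factor
  \<open>1 + chi s = 2\<close> of the Riesz product.\<close>

lemma tauE_Fpi:
  assumes "\<And>l. m l < 2 ^ k"
  shows "tauE (Fpi p) k m = riesz (nconstr k) (pt k m) / 2 ^ (CARD('d) * k)"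
  using assms
proof (induction k arbitrary: m)
  case 0
  have "nconstr 0 = 0" by (rule nconstr_eqI) simp
  then show ?case using 0 by (simp add: riesz_def)
next
  case (Suc k)
  define C where "C = {c. \<forall>l. c l \<in> {c. c div 2 = m l div 2}}"
  have set: "{c. c div 2 = b} = {2 * b, 2 * b + 1}" for b :: nat by auto
  have finC: "finite C"
    unfolding C_def by (rule finite_box) (simp add: set)
  have cardC: "card C = 2 ^ CARD('d)"
    unfolding C_def box_eq_PiE by (subst card_PiE) (simp_all add: set flip: numeral_2_eq_2)
  have parent: "chi t (pt (Suc k) c) = chi t (pt k (\<lambda>l. m l div 2))" if "c \<in> C" "t < nconstr k" for c t
    by (rule chi_cong, rule pt_Suc) (use that less_nconstr_iff[of t k] in \<open>auto simp: C_def\<close>)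
  have mC: "m \<in> C" by (simp add: C_def)
  have "riesz (nconstr k) (pt (Suc k) m) = riesz (nconstr k) (pt k (\<lambda>l. m l div 2))"
    unfolding riesz_def by (rule prod.cong) (use parent[OF mC] in auto)
  moreover have "tauE (Fpi p) k (\<lambda>l. m l div 2) =
      riesz (nconstr k) (pt k (\<lambda>l. m l div 2)) / 2 ^ (CARD('d) * k)"
    by (rule Suc.IH) (use Suc.prems in \<open>simp add: less_mult_imp_div_less mult.commute\<close>)
  ultimately have IH: "tauE (Fpi p) k (\<lambda>l. m l div 2) =
      riesz (nconstr k) (pt (Suc k) m) / 2 ^ (CARD('d) * k)" by simp
  have meets: "dcube (Suc k) c \<inter> Fpi p \<noteq> {} \<longleftrightarrow> (\<forall>t<nconstr (Suc k). chi t (pt (Suc k) c) = 1)" for c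
    unfolding dcube_meets_Fpi_iff less_nconstr_iff ..
  show ?case
  proof (cases "\<forall>t<nconstr (Suc k). chi t (pt (Suc k) m) = 1")
    case False
    then obtain t where "t < nconstr (Suc k)" "chi t (pt (Suc k) m) = -1"
      using chi_sign by blast
    then have "riesz (nconstr (Suc k)) (pt (Suc k) m) = 0"
      unfolding riesz_def by (subst prod_zero_iff) force+
    moreover have "tauE (Fpi p) (Suc k) m = 0"
      using False unfolding tauE.simps meets by auto
    ultimately show ?thesis by simp
  next
    case True
    define D where "D = {c \<in> C. \<forall>t<nconstr (Suc k). chi t (pt (Suc k) c) = 1}"
    have tau: "tauE (Fpi p) (Suc k) m =
        riesz (nconstr k) (pt (Suc k) m) / 2 ^ (CARD('d) * k) / real (card D)"
      using True Suc.prems unfolding tauE.simps meets IH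
      by (simp add: D_def C_def)
    show ?thesis
    proof (cases "\<exists>s. k = 2 * M s")
      case False
      then have nconstr: "nconstr (Suc k) = nconstr k"
        by (intro nconstr_eqI) (auto simp: less_nconstr_iff less_Suc_eq)
      have "D = C"
        using True parent mC unfolding D_def nconstr by auto
      then show ?thesis
        unfolding tau nconstr by (simp add: power_add cardC)
    next
      case True': True
      then obtain s where s: "k = 2 * M s" by blast
      have M_iff: "M t < M s \<longleftrightarrow> t < s" "M t \<le> M s \<longleftrightarrow> t \<le> s" for t
        using M_less[of t s] M_less[of s t] by (cases t s rule: linorder_cases; simp)+
      have nconstr: "nconstr k = s" "nconstr (Suc k) = Suc s"
        by (intro nconstr_eqI; simp add: s M_iff less_Suc_eq_le)+
      have "D = {c \<in> C. chi s (pt (Suc k) c) = 1}"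
        using True parent mC unfolding D_def nconstr by (auto simp: less_Suc_eq)
      then have "real (card D) = (\<Sum>c\<in>C. if chi s (pt (Suc k) c) = 1 then 1 else 0)"
        using finC by (simp add: sum.If_cases Int_def)
      \<comment> \<open>\<open>chi s\<close> is a sign, so the indicator is
        \<open>(1 + chi s) / 2\<close>; the sum of \<open>chi s\<close> over the siblings factors
        into coordinates and vanishes.\<close>
      also have "\<dots> = (\<Sum>c\<in>C. (1 + chi s (pt (Suc k) c)) / 2)"
        by (rule sum.cong) (use chi_sign in auto, force)
      also have "\<dots> = (2 ^ CARD('d) + (\<Sum>c\<in>C. chi s (pt (Suc k) c))) / 2"
        by (simp add: sum.distrib cardC flip: sum_divide_distrib)
      also have "(\<Sum>c\<in>C. chi s (pt (Suc k) c)) = 0"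
        unfolding C_def chi_def pt_def s
        by (subst sum_box_prod) (simp_all add: set sum_chi1_children[unfolded set, simplified])
      finally have cardD: "real (card D) = 2 ^ CARD('d) / 2" by simp
      have riesz: "riesz (nconstr (Suc k)) (pt (Suc k) m) = riesz (nconstr k) (pt (Suc k) m) * 2"
        using True by (simp add: nconstr riesz_Suc)
      show ?thesis
        unfolding tau cardD riesz by (simp add: power_add)
    qed
  qed
qed

end

subsection \<open>Walsh coefficients of the quasimeasure\<close>

abbreviation box :: "nat \<Rightarrow> 'd idx set" where
  "box k \<equiv> {m. \<forall>l. m l \<in> {..<2 ^ k}}"

lemma finite_box_pow: "finite (box k :: 'd::finite idx set)"
  by (rule finite_box) simp

lemma sum_walsh_pt:
  fixes n :: "'d::finite idx"
  assumes "\<And>l. n l < 2 ^ k"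
  shows "(\<Sum>m\<in>box k. walsh n (pt k m)) = of_bool (n = (\<lambda>_. 0)) * 2 ^ (CARD('d) * k)"
proof -
  have "(\<Sum>m\<in>box k. walsh n (pt k m)) = (\<Prod>l\<in>UNIV. if n l = 0 then 2 ^ k else 0)"
    unfolding walsh_def pt_def by (subst sum_box_prod) (simp_all add: sum_walsh1_pt1 assms)
  also have "\<dots> = of_bool (n = (\<lambda>_. 0)) * 2 ^ (CARD('d) * k)"
  proof (cases "n = (\<lambda>_. 0)")
    case False
    then obtain l where "n l \<noteq> 0" by auto
    then show ?thesis using False by (subst prod_zero) auto
  qed (simp flip: power_mult add: mult.commute)
  finally show ?thesis .
qed

context riesz_set
begin

text \<open>A one-dimensional Walsh coefficient: of the function that is the Walsh function of
  frequency \<open>2 ^ M s * freq s l a\<close> on interval \<open>a\<close> of rank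
  \<open>M s\<close> and 0 elsewhere.\<close>

definition block_coeff1 :: "nat \<Rightarrow> 'd \<Rightarrow> nat \<Rightarrow> nat \<Rightarrow> real" where
  "block_coeff1 s l a n = (if n div 2 ^ M s = freq s l a then walsh1 (n mod 2 ^ M s) (pt1 (M s) a) / 2 ^ M s else 0)"

text \<open>The \<open>n\<close>-th Walsh coefficient of \<open>riesz s * chi s\<close>, assembled
  cube by cube.\<close>

definition block_coeff :: "nat \<Rightarrow> 'd idx \<Rightarrow> real" where
  "block_coeff s n = (\<Sum>a\<in>box (M s). riesz s (pt (M s) a) * (\<Prod>l\<in>UNIV. block_coeff1 s l (a l) (n l)))"

lemma riesz_pt_agree:
  assumes "\<And>l t. t < M s \<Longrightarrow> g l t = h l t"
  shows "riesz s g = riesz s h"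
proof (rule riesz_cong)
  fix l t i assume "i < s" "t < 2 * M i + 1"
  then show "g l t = h l t"
    using M_less[of i s] assms by simp
qed

text \<open>Points of rank \<open>K\<close> are grouped by their ancestor \<open>a\<close> of rank
  \<open>M s\<close>. On each group \<open>riesz s\<close> is constant and \<open>chi s\<close> is a
  product of Walsh functions with fixed frequencies, so the sum factors over the
  coordinates.\<close>

lemma sum_walsh_riesz_chi:
  assumes "2 * M s < K" "\<And>l. n l < 2 ^ K"
  shows "(\<Sum>m\<in>box K. walsh n (pt K m) * (riesz s (pt K m) * chi s (pt K m))) = block_coeff s n * 2 ^ (CARD('d) * K)"
    (is "sum ?f _ = _")
proof -
  define j where "j = K - M s"
  \<comment> \<open>The bound on \<open>j\<close> makes room for the \<open>M s + 1\<close> digits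
    of \<open>freq s l (a l)\<close>.\<close>
  have K: "K = M s + j" and j: "M s + 1 \<le> j"
    using assms(1) by (auto simp: j_def)
  have inner: "sum ?f {m \<in> box K. (\<lambda>l. m l div 2 ^ j) = a} =
      riesz s (pt (M s) a) * (\<Prod>l\<in>UNIV. block_coeff1 s l (a l) (n l)) * 2 ^ (CARD('d) * K)"
    if a: "a \<in> box (M s)" for a
  proof -
    have lt: "m < 2 ^ K" if "m div 2 ^ j = a l" for m l
      using a that unfolding K power_add
      by (metis (mono_tags, lifting) div_less_iff_less_mult lessThan_iff mem_Collect_eq
          zero_less_numeral zero_less_power)
    have set: "{m \<in> box K. (\<lambda>l. m l div 2 ^ j) = a} = {m. \<forall>l. m l \<in> {m. m div 2 ^ j = a l}}"
      using lt by auto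
    have fin: "finite {m. m div 2 ^ j = a l}" for l
      by (rule finite_subset[of _ "{..<2 ^ K}"]) (use lt in auto)
    have f: "?f m = riesz s (pt (M s) a) *
        (\<Prod>l\<in>UNIV. walsh1 (n l) (pt1 K (m l)) * walsh1 (2 ^ M s * freq s l (a l)) (pt1 K (m l)))"
      if m: "\<forall>l. m l \<in> {m. m div 2 ^ j = a l}" for m
    proof -
      have "riesz s (pt K m) = riesz s (pt (M s) a)"
        by (rule riesz_pt_agree) (use m in \<open>simp add: pt_def K pt1_div\<close>)
      moreover have "idx1 (M s) (pt1 K (m l)) = a l" for l
      proof -
        have "idx1 (M s) (pt1 K (m l)) = idx1 (M s) (pt1 (M s) (a l))"
          by (rule idx1_cong) (use m in \<open>simp add: K pt1_div\<close>)
        then show ?thesis using a by (simp add: idx1_pt1)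
      qed
      then have "chi s (pt K m) = (\<Prod>l\<in>UNIV. walsh1 (2 ^ M s * freq s l (a l)) (pt1 K (m l)))"
        by (simp add: chi_def chi1_def pt_def)
      ultimately show ?thesis
        by (simp add: walsh_def pt_def prod.distrib)
    qed
    have one_dim: "(\<Sum>m | m div 2 ^ j = a l.
        walsh1 (n l) (pt1 K m) * walsh1 (2 ^ M s * freq s l (a l)) (pt1 K m)) =
        block_coeff1 s l (a l) (n l) * 2 ^ K" for l
    proof -
      have "freq s l (a l) < 2 ^ (M s + 1)"
        using a by (intro freq_less) auto
      also have "\<dots> \<le> 2 ^ j"
        using j by (intro power_increasing) auto
      finally have "freq s l (a l) < 2 ^ j" .
      moreover have "n l < 2 ^ (M s + j)"
        using assms(2) K by simp
      ultimately show ?thesis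
        unfolding K by (subst sum_walsh1_mult_subcube) (auto simp: block_coeff1_def power_add)
    qed
    have "sum ?f {m \<in> box K. (\<lambda>l. m l div 2 ^ j) = a} = riesz s (pt (M s) a) *
        (\<Prod>l\<in>UNIV. \<Sum>m | m div 2 ^ j = a l.
          walsh1 (n l) (pt1 K m) * walsh1 (2 ^ M s * freq s l (a l)) (pt1 K m))"
      unfolding set sum_box_prod[OF fin, symmetric] sum_distrib_left
      by (rule sum.cong) (use f in auto)
    also have "\<dots> = riesz s (pt (M s) a) * (\<Prod>l\<in>UNIV. block_coeff1 s l (a l) (n l) * 2 ^ K)"
      unfolding one_dim ..
    finally show ?thesis
      by (simp add: prod.distrib mult.commute[of "CARD('d)"] power_mult)
  qed
  have "(\<lambda>m l. m l div 2 ^ j) ` box K \<subseteq> box (M s)"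
    by (auto simp: K power_add less_mult_imp_div_less)
  then have "sum ?f (box K) = (\<Sum>a\<in>box (M s). sum ?f {m \<in> box K. (\<lambda>l. m l div 2 ^ j) = a})"
    by (intro sum.group[symmetric] finite_box_pow)
  also have "\<dots> = (\<Sum>a\<in>box (M s).
      riesz s (pt (M s) a) * (\<Prod>l\<in>UNIV. block_coeff1 s l (a l) (n l)) * 2 ^ (CARD('d) * K))"
    using inner by (rule sum.cong[OF refl])
  finally show ?thesis
    by (simp add: block_coeff_def sum_distrib_right)
qed

text \<open>Some cube \<open>a\<close> contributes in all coordinates at once, so every
  \<open>n l div 2 ^ M s\<close> is a value of \<open>freq\<close>.\<close>

lemma block_coeff_support:
  assumes "block_coeff s n \<noteq> 0"
  shows "2 ^ (2 * M s) \<le> n l" "n l < 2 ^ (2 * M s + 1)"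
proof -
  obtain a where a: "a \<in> box (M s)" "(\<Prod>l\<in>UNIV. block_coeff1 s l (a l) (n l)) \<noteq> 0"
    using assms unfolding block_coeff_def by (metis (no_types, lifting) sum.neutral mult_zero_right)
  then have "block_coeff1 s l (a l) (n l) \<noteq> 0" by auto
  then have f: "n l div 2 ^ M s = freq s l (a l)"
    by (auto simp: block_coeff1_def split: if_splits)
  have "2 ^ M s * 2 ^ M s \<le> 2 ^ M s * (n l div 2 ^ M s)"
    unfolding f using freq_ge by simp
  also have "\<dots> \<le> n l" by simp
  finally show "2 ^ (2 * M s) \<le> n l"
    by (simp add: mult_2 power_add)
  have "n l div 2 ^ M s < 2 ^ (M s + 1)"
    unfolding f using a by (intro freq_less) auto
  then have "n l < 2 ^ (M s + 1) * 2 ^ M s"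
    by (subst (asm) div_less_iff_less_mult) auto
  then show "n l < 2 ^ (2 * M s + 1)"
    by (simp add: mult_2 power_add distrib_left distrib_right)
qed

text \<open>\<open>qcoeff\<close> uses a rank depending on \<open>n\<close>; here any sufficiently
  large \<open>s\<close> serves, so that one \<open>s\<close> covers a whole rectangle of
  frequencies.\<close>

lemma qcoeff_eq_sum_block_coeff:
  assumes "\<And>l. n l < 2 ^ (2 * M s)"
  shows "qcoeff (tauE (Fpi p)) n = of_bool (n = (\<lambda>_. 0)) + (\<Sum>t<s. block_coeff t n)"
proof -
  define K where "K = (LEAST k. \<forall>l. n l < 2 ^ k)"
  have n: "n l < 2 ^ K" for l
    using LeastI[of "\<lambda>k. \<forall>l. n l < 2 ^ k" "2 * M s"] assms unfolding K_def by blast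
  have K: "K \<le> 2 * M s"
    unfolding K_def by (rule Least_le) (use assms in blast)
  have "nconstr K \<le> s"
    using K less_nconstr_iff[of s K] by simp
  \<comment> \<open>Blocks from stage \<open>nconstr K\<close> on start at \<open>2 ^ K\<close> or
    above and so miss \<open>n\<close>. Any coordinate shows this; \<open>undefined\<close> is an
    arbitrary one.\<close>
  have "block_coeff t n = 0" if "nconstr K \<le> t" for t
  proof (rule ccontr)
    assume "block_coeff t n \<noteq> 0"
    then have "2 ^ (2 * M t) \<le> n undefined" by (rule block_coeff_support)
    also have "\<dots> < 2 ^ K" by (rule n)
    finally have "2 * M t < K" by simp
    then show False using that by (simp flip: less_nconstr_iff)
  qed
  then have tail: "(\<Sum>t<nconstr K. block_coeff t n) = (\<Sum>t<s. block_coeff t n)"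
    using \<open>nconstr K \<le> s\<close> by (intro sum.mono_neutral_left) auto
  have "qcoeff (tauE (Fpi p)) n =
      (\<Sum>m\<in>box K. walsh n (pt K m) * (riesz (nconstr K) (pt K m) / 2 ^ (CARD('d) * K)))"
    unfolding qcoeff_def K_def[symmetric] Let_def
    by (rule sum.cong) (auto simp: wconst_eq tauE_Fpi)
  also have "\<dots> = (\<Sum>m\<in>box K. walsh n (pt K m) * riesz (nconstr K) (pt K m)) / 2 ^ (CARD('d) * K)"
    by (simp add: sum_divide_distrib)
  also have "(\<Sum>m\<in>box K. walsh n (pt K m) * riesz (nconstr K) (pt K m)) =
      (\<Sum>m\<in>box K. walsh n (pt K m)) +
      (\<Sum>t<nconstr K. \<Sum>m\<in>box K. walsh n (pt K m) * (riesz t (pt K m) * chi t (pt K m)))"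
    unfolding riesz_expand[of "nconstr K"]
    by (simp add: distrib_left sum.distrib sum_distrib_left sum.swap[of _ _ "{..<nconstr K}"])
  also have "\<dots> = of_bool (n = (\<lambda>_. 0)) * 2 ^ (CARD('d) * K)
      + (\<Sum>t<nconstr K. block_coeff t n * 2 ^ (CARD('d) * K))"
    using n by (intro arg_cong2[where f = "(+)"] sum.cong sum_walsh_pt sum_walsh_riesz_chi)
      (auto simp: less_nconstr_iff)
  also have "\<dots> / 2 ^ (CARD('d) * K) = of_bool (n = (\<lambda>_. 0)) + (\<Sum>t<nconstr K. block_coeff t n)"
    by (simp add: add_divide_distrib flip: sum_distrib_right)
  finally show ?thesis using tail by simp
qed

text \<open>A frequency other than 0 with nonzero coefficient has all coordinates in one range from
  a power of 2 to its double.\<close>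

lemma qcoeff_diagonal:
  assumes "qcoeff (tauE (Fpi p)) n \<noteq> 0"
  shows "n l \<le> 2 * n l'"
proof -
  obtain s where s: "\<And>l. n l < 2 ^ (2 * M s)"
    using ex_less_pow_M[of n] by blast
  show ?thesis
  proof (cases "n = (\<lambda>_. 0)")
    case False
    then have "(\<Sum>t<s. block_coeff t n) \<noteq> 0"
      using assms qcoeff_eq_sum_block_coeff[OF s] by simp
    then obtain t where "block_coeff t n \<noteq> 0"
      by (metis sum.neutral)
    then show ?thesis
      using block_coeff_support(1)[of t n l'] block_coeff_support(2)[of t n l] by simp
  qed simp
qed

subsection \<open>Rectangular partial sums\<close>

definition block_kernel :: "nat \<Rightarrow> 'd \<Rightarrow> nat \<Rightarrow> nat \<Rightarrow> (nat \<Rightarrow> bool) \<Rightarrow> real" where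
  "block_kernel s l a N y = (\<Sum>n<N. block_coeff1 s l a n * walsh1 n y)"

text \<open>The share of stage \<open>s\<close> in the rectangular partial sum, with the sum over
  cubes outermost so that the rest factors over the coordinates.\<close>

definition block_psum :: "nat \<Rightarrow> 'd idx \<Rightarrow> 'd point \<Rightarrow> real" where
  "block_psum s N g = (\<Sum>a\<in>box (M s). riesz s (pt (M s) a) * (\<Prod>l\<in>UNIV. block_kernel s l (a l) (N l) (g l)))"

lemma psum_qcoeff:
  assumes "\<And>l. 1 \<le> N l" "\<And>l. N l \<le> 2 ^ (2 * M s)"
  shows "psum (qcoeff (tauE (Fpi p))) N g = 1 + (\<Sum>t<s. block_psum t N g)"
proof -
  let ?R = "{n. \<forall>l. n l \<in> {..<N l}}"
  have fin: "finite ?R"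
    by (rule finite_box) simp
  \<comment> \<open>Frequency 0 supplies the summand 1.\<close>
  have zero: "(\<lambda>_. 0) \<in> ?R"
    using assms(1) by (auto simp: Suc_le_eq)
  have block_coeff: "(\<Sum>n\<in>?R. block_coeff t n * walsh n g) = block_psum t N g" for t
  proof -
    have "(\<Sum>n\<in>?R. block_coeff t n * walsh n g) = (\<Sum>n\<in>?R. \<Sum>a\<in>box (M t).
        riesz t (pt (M t) a) * (\<Prod>l\<in>UNIV. block_coeff1 t l (a l) (n l) * walsh1 (n l) (g l)))"
      by (simp add: block_coeff_def walsh_def sum_distrib_right prod.distrib mult.assoc)
    also have "\<dots> = (\<Sum>a\<in>box (M t). riesz t (pt (M t) a) *
        (\<Sum>n\<in>?R. \<Prod>l\<in>UNIV. block_coeff1 t l (a l) (n l) * walsh1 (n l) (g l)))"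
      by (subst sum.swap) (simp add: sum_distrib_left)
    also have "\<dots> = block_psum t N g"
      unfolding block_psum_def block_kernel_def by (subst sum_box_prod) auto
    finally show ?thesis .
  qed
  have "psum (qcoeff (tauE (Fpi p))) N g =
      (\<Sum>n\<in>?R. (of_bool (n = (\<lambda>_. 0)) + (\<Sum>t<s. block_coeff t n)) * walsh n g)"
    unfolding psum_def lessThan_iff
    using assms(2) by (intro sum.cong refl arg_cong2[where f = "(*)"] qcoeff_eq_sum_block_coeff)
      (auto intro: less_le_trans)
  also have "\<dots> = (\<Sum>n\<in>?R. if n = (\<lambda>_. 0) then walsh n g else 0)
      + (\<Sum>t<s. \<Sum>n\<in>?R. block_coeff t n * walsh n g)"
    by (simp add: distrib_right sum.distrib sum_distrib_right sum.swap[of _ _ "{..<s}"]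
        of_bool_def if_distrib[of "\<lambda>x. x * _"] cong: if_cong)
  also have "(\<Sum>n\<in>?R. if n = (\<lambda>_. 0) then walsh n g else 0) = 1"
    using fin zero by (simp add: sum.delta walsh_def)
  finally show ?thesis
    unfolding block_coeff .
qed

text \<open>The frequencies of \<open>block_coeff1 s l a\<close> form one run of length
  \<open>2 ^ M s\<close>, with Walsh values at the corner of \<open>a\<close> as coefficients.
  Values at two points multiply to the value at their sum; \<open>min\<close> and truncated
  subtraction cut the run at \<open>N\<close>.\<close>

lemma block_kernel_eq_dirichlet:
  "block_kernel s l a N y = walsh1 (2 ^ M s * freq s l a) y *
     dirichlet (min (2 ^ M s) (N - 2 ^ M s * freq s l a)) (\<lambda>t. pt1 (M s) a t \<noteq> y t) / 2 ^ M s"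
proof -
  let ?lo = "2 ^ M s * freq s l a"
  let ?b = "min (2 ^ M s) (N - ?lo)"
  have set: "{n \<in> {..<N}. n div 2 ^ M s = freq s l a} = (\<lambda>v. ?lo + v) ` {..<?b}"
  proof -
    have "n \<in> (\<lambda>v. ?lo + v) ` {..<?b}" if "n < N" "n div 2 ^ M s = freq s l a" for n
    proof -
      have eq: "?lo + n mod 2 ^ M s = n"
        using mult_div_mod_eq[of "2 ^ M s" n] that(2) by simp
      then have "n mod 2 ^ M s < N - ?lo"
        using that(1) by linarith
      then show ?thesis
        using eq by (intro image_eqI[of _ _ "n mod 2 ^ M s"]) auto
    qed
    then show ?thesis by (auto simp: less_diff_conv add.commute)
  qed
  have "block_kernel s l a N y = (\<Sum>n\<in>{n \<in> {..<N}. n div 2 ^ M s = freq s l a}.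
      walsh1 (n mod 2 ^ M s) (pt1 (M s) a) / 2 ^ M s * walsh1 n y)"
    unfolding block_kernel_def block_coeff1_def
    by (subst sum.inter_filter) (auto intro!: sum.cong)
  also have "\<dots> = (\<Sum>v<?b. walsh1 v (pt1 (M s) a) / 2 ^ M s * walsh1 (?lo + v) y)"
    unfolding set by (subst sum.reindex) (auto simp: inj_on_def intro!: sum.cong)
  also have "\<dots> = (\<Sum>v<?b. walsh1 ?lo y * walsh1 v (\<lambda>t. pt1 (M s) a t \<noteq> y t) / 2 ^ M s)"
    unfolding walsh1_mult_point[symmetric]
    by (intro sum.cong refl) (auto simp: walsh1_pow_add walsh1_pow_mult)
  finally show ?thesis
    by (simp add: dirichlet_def sum_distrib_left sum_divide_distrib)
qed

text \<open>A full run is a Dirichlet kernel of length \<open>2 ^ M s\<close>, which detects whether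
  \<open>y\<close> lies in interval \<open>a\<close>.\<close>

lemma block_kernel_complete:
  assumes "a < 2 ^ M s" "2 ^ M s * freq s l a + 2 ^ M s \<le> N"
  shows "block_kernel s l a N y = (if a = idx1 (M s) y then chi1 s l y else 0)"
proof -
  have "min (2 ^ M s) (N - 2 ^ M s * freq s l a) = 2 ^ M s"
    using assms by auto
  then show ?thesis
    using pt1_eq_iff_idx1[OF assms(1), of y]
    by (auto simp: block_kernel_eq_dirichlet dirichlet_pow chi1_def)
qed

lemma block_kernel_full:
  assumes "a < 2 ^ M s" "2 ^ (2 * M s + 1) \<le> N"
  shows "block_kernel s l a N y = (if a = idx1 (M s) y then chi1 s l y else 0)"
proof (rule block_kernel_complete[OF assms(1)])
  have "2 ^ M s * (freq s l a + 1) \<le> 2 ^ M s * 2 ^ (M s + 1)"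
    using freq_less[OF assms(1), of l] by (intro mult_left_mono) auto
  also have "\<dots> = 2 ^ (2 * M s + 1)"
    by (simp add: mult_2 power_add distrib_left distrib_right)
  finally show "2 ^ M s * freq s l a + 2 ^ M s \<le> N"
    using assms(2) by simp
qed

lemma block_kernel_empty:
  assumes "N \<le> 2 ^ M s * freq s l a"
  shows "block_kernel s l a N y = 0"
  using assms by (simp add: block_kernel_eq_dirichlet dirichlet_def)

lemma block_kernel_zero:
  assumes "N \<le> 2 ^ (2 * M s)"
  shows "block_kernel s l a N y = 0"
proof (rule block_kernel_empty)
  have "2 ^ (2 * M s) \<le> 2 ^ M s * freq s l a"
    using freq_ge[of s l a] by (simp add: mult_2 power_add)
  then show "N \<le> 2 ^ M s * freq s l a"
    using assms by simp
qed

lemma block_kernel_trichotomy: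
  obtains "N \<le> 2 ^ M s * freq s l a" | "2 ^ M s * freq s l a + 2 ^ M s \<le> N"
    | "freq s l a = N div 2 ^ M s"
proof (cases "2 ^ M s * freq s l a < N \<and> N < 2 ^ M s * freq s l a + 2 ^ M s")
  case True
  then have "N div 2 ^ M s = freq s l a"
    by (intro div_nat_eqI) auto
  then show ?thesis using that by simp
qed (use that in \<open>auto simp: not_less\<close>)

lemma abs_block_kernel_le:
  assumes "a < 2 ^ M s"
  shows "\<bar>block_kernel s l a N y\<bar> \<le> of_bool (a = idx1 (M s) y) + of_bool (freq s l a = N div 2 ^ M s)"
proof (cases rule: block_kernel_trichotomy[of N s l a])
  case 1
  then show ?thesis by (simp add: block_kernel_empty)
next
  case 2
  then show ?thesis using block_kernel_complete[OF assms 2, of y] by (auto simp: chi1_def)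
next
  case 3
  have "\<bar>block_kernel s l a N y\<bar> \<le> real (min (2 ^ M s) (N - 2 ^ M s * freq s l a)) / 2 ^ M s"
    unfolding block_kernel_eq_dirichlet by (simp add: abs_mult divide_right_mono abs_dirichlet_le)
  also have "\<dots> \<le> real (2 ^ M s) / 2 ^ M s"
    by (intro divide_right_mono of_nat_mono) auto
  also have "\<dots> \<le> of_bool (a = idx1 (M s) y) + of_bool (freq s l a = N div 2 ^ M s)"
    using 3 by simp
  finally show ?thesis .
qed

text \<open>With a difference within the first \<open>k\<close> bits a complete kernel vanishes, and
  the Dirichlet sum of a cut one is bounded by \<open>2 ^ k\<close> instead of
  \<open>2 ^ M s\<close>.\<close>

lemma abs_block_kernel_le_differ:
  assumes "a < 2 ^ M s" "pt1 (M s) a i \<noteq> y i" "i < k" "k \<le> M s"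
  shows "\<bar>block_kernel s l a N y\<bar> \<le> 2 ^ k / 2 ^ M s * of_bool (freq s l a = N div 2 ^ M s)"
proof (cases rule: block_kernel_trichotomy[of N s l a])
  case 1
  then show ?thesis by (simp add: block_kernel_empty)
next
  case 2
  have "a \<noteq> idx1 (M s) y"
    using assms pt1_eq_iff_idx1[OF assms(1), of y] by auto
  then show ?thesis using block_kernel_complete[OF assms(1) 2, of y] by simp
next
  case 3
  have "\<bar>block_kernel s l a N y\<bar> \<le> 2 ^ k / 2 ^ M s"
    unfolding block_kernel_eq_dirichlet
    using abs_dirichlet_le_pow[of "\<lambda>t. pt1 (M s) a t \<noteq> y t" i k] assms
    by (simp add: abs_mult divide_right_mono)
  then show ?thesis using 3 by simp
qed

text \<open>Injectivity of the permutations enters here: in each coordinate at most one interval has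
  its run of frequencies cut.\<close>

lemma sum_of_bool_freq_le: "(\<Sum>a<2 ^ M s. of_bool (freq s l a = c)) \<le> (1::real)"
proof -
  have "card {a \<in> {..<2 ^ M s}. freq s l a = c} \<le> 1"
    by (simp add: card_le_Suc0_iff_eq) (use freq_inj in blast)
  then show ?thesis by (simp add: Int_def)
qed

lemma block_psum_full:
  assumes "\<And>l. 2 ^ (2 * M s + 1) \<le> N l"
  shows "block_psum s N g = riesz s g * chi s g"
proof -
  define b where "b = (\<lambda>l. idx1 (M s) (g l))"
  have b: "b \<in> box (M s)"
    by (simp add: b_def idx1_less)
  have block_kernel: "block_kernel s l (a l) (N l) (g l) = (if a l = b l then chi1 s l (g l) else 0)"
    if "a \<in> box (M s)" for a l
    using that assms by (simp add: block_kernel_full b_def)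
  have "block_psum s N g = (\<Sum>a\<in>{b}. riesz s (pt (M s) a) * (\<Prod>l\<in>UNIV. block_kernel s l (a l) (N l) (g l)))"
    unfolding block_psum_def
  proof (rule sum.mono_neutral_right)
    show "\<forall>a\<in>box (M s) - {b}. riesz s (pt (M s) a) * (\<Prod>l\<in>UNIV. block_kernel s l (a l) (N l) (g l)) = 0"
    proof
      fix a assume a: "a \<in> box (M s) - {b}"
      then obtain l where "a l \<noteq> b l" by auto
      then have "block_kernel s l (a l) (N l) (g l) = 0"
        using block_kernel[of a l] a by simp
      then have "(\<Prod>l\<in>UNIV. block_kernel s l (a l) (N l) (g l)) = 0"
        by (intro prod_zero) auto
      then show "riesz s (pt (M s) a) * (\<Prod>l\<in>UNIV. block_kernel s l (a l) (N l) (g l)) = 0"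
        by simp
    qed
  qed (use b finite_box_pow in auto)
  also have "\<dots> = riesz s (pt (M s) b) * chi s g"
    using block_kernel[OF b] by (simp add: chi_def)
  also have "riesz s (pt (M s) b) = riesz s g"
    by (rule riesz_pt_agree) (simp add: pt_def b_def pt1_idx1)
  finally show ?thesis .
qed

lemma block_psum_zero:
  assumes "N l \<le> 2 ^ (2 * M s)"
  shows "block_psum s N g = 0"
proof -
  have "(\<Prod>l\<in>UNIV. block_kernel s l (a l) (N l) (g l)) = 0" for a
    using block_kernel_zero[OF assms] by (intro prod_zero) auto
  then show ?thesis
    unfolding block_psum_def by (simp only: mult_zero_right sum.neutral_const)
qed

text \<open>Each cube of nonzero density differs early from \<open>g\<close> in some coordinate
  \<open>j\<close>. After summing over all \<open>j\<close> the bound factors: each coordinate gives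
  at most 2, and coordinate \<open>j\<close> the extra factor
  \<open>2 ^ k / 2 ^ M s\<close>.\<close>

lemma abs_block_psum_le:
  assumes "k \<le> M s"
    and differ: "\<And>a. a \<in> box (M s) \<Longrightarrow> riesz s (pt (M s) a) \<noteq> 0 \<Longrightarrow>
      \<exists>l. \<exists>i<k. pt1 (M s) (a l) i \<noteq> g l i"
  shows "\<bar>block_psum s N g\<bar> \<le> 2 ^ s * (CARD('d) * (2 ^ CARD('d) * (2 ^ k / 2 ^ M s)))"
proof -
  define bad where "bad = (\<lambda>l a. \<exists>i<k. pt1 (M s) a i \<noteq> g l i)"
  define \<kappa> where "\<kappa> = (\<lambda>l a. \<bar>block_kernel s l a (N l) (g l)\<bar>)"
  \<comment> \<open>The indicator in coordinate \<open>j\<close> lets the sum over \<open>a\<close>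
    run over the full box and still factor.\<close>
  define \<kappa>' where "\<kappa>' = (\<lambda>j l a. \<kappa> l a * (if l = j then of_bool (bad l a) else 1))"
  have nonneg: "0 \<le> \<kappa>' j l a" for j l a
    by (simp add: \<kappa>'_def \<kappa>_def)
  have pointwise: "\<bar>riesz s (pt (M s) a) * (\<Prod>l\<in>UNIV. block_kernel s l (a l) (N l) (g l))\<bar> \<le>
      2 ^ s * (\<Sum>j\<in>UNIV. \<Prod>l\<in>UNIV. \<kappa>' j l (a l))" if a: "a \<in> box (M s)" for a
  proof (cases "riesz s (pt (M s) a) = 0")
    case True
    then show ?thesis
      by (simp add: nonneg sum_nonneg prod_nonneg)
  next
    case False
    then obtain j where j: "bad j (a j)"
      using differ[OF a] by (auto simp: bad_def)
    have "(\<Prod>l\<in>UNIV. \<kappa> l (a l)) = (\<Prod>l\<in>UNIV. \<kappa>' j l (a l))"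
      using j by (intro prod.cong) (auto simp: \<kappa>'_def)
    also have "\<dots> \<le> (\<Sum>j\<in>UNIV. \<Prod>l\<in>UNIV. \<kappa>' j l (a l))"
      by (rule member_le_sum) (auto simp: nonneg intro!: prod_nonneg)
    finally show ?thesis
      unfolding abs_mult abs_prod \<kappa>_def[symmetric]
      using riesz_le[of s "pt (M s) a"] riesz_nonneg[of s "pt (M s) a"]
      by (intro mult_mono) (auto simp: \<kappa>_def intro!: prod_nonneg)
  qed
  have factor: "(\<Sum>a<2 ^ M s. \<kappa>' j l a) \<le> 2 * (if l = j then 2 ^ k / 2 ^ M s else 1)" for j l
  proof (cases "l = j")
    case True
    have "(\<Sum>a<2 ^ M s. \<kappa>' j l a) \<le>
        (\<Sum>a<2 ^ M s. 2 ^ k / 2 ^ M s * of_bool (freq s l a = N l div 2 ^ M s))"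
    proof (rule sum_mono)
      fix a :: nat assume a: "a \<in> {..<2 ^ M s}"
      show "\<kappa>' j l a \<le> 2 ^ k / 2 ^ M s * of_bool (freq s l a = N l div 2 ^ M s)"
      proof (cases "bad l a")
        case True': True
        then obtain i where "i < k" "pt1 (M s) a i \<noteq> g l i"
          by (auto simp: bad_def)
        then show ?thesis
          using abs_block_kernel_le_differ[of a s i "g l" k l "N l"] a assms(1) True True'
          by (simp add: \<kappa>'_def \<kappa>_def)
      qed (use True in \<open>simp add: \<kappa>'_def\<close>)
    qed
    also have "\<dots> \<le> 2 ^ k / 2 ^ M s * 1"
      unfolding sum_distrib_left[symmetric] by (intro mult_left_mono sum_of_bool_freq_le) simp
    also have "\<dots> \<le> 2 * (2 ^ k / 2 ^ M s)"
      by (simp add: divide_right_mono)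
    finally show ?thesis using True by simp
  next
    case False
    have "(\<Sum>a<2 ^ M s. \<kappa>' j l a) \<le> (\<Sum>a<2 ^ M s.
        of_bool (a = idx1 (M s) (g l)) + of_bool (freq s l a = N l div 2 ^ M s))"
      using False abs_block_kernel_le by (intro sum_mono) (auto simp: \<kappa>'_def \<kappa>_def simp del: of_bool_eq)
    also have "\<dots> \<le> 1 + 1"
      unfolding sum.distrib
      by (intro add_mono sum_of_bool_freq_le) (simp add: of_bool_def sum.delta idx1_less)
    finally show ?thesis using False by simp
  qed
  have "\<bar>block_psum s N g\<bar> \<le> (\<Sum>a\<in>box (M s). 2 ^ s * (\<Sum>j\<in>UNIV. \<Prod>l\<in>UNIV. \<kappa>' j l (a l)))"
    unfolding block_psum_def using pointwise by (rule order_trans[OF sum_abs sum_mono])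
  also have "\<dots> = 2 ^ s * (\<Sum>j\<in>UNIV. \<Sum>a\<in>box (M s). \<Prod>l\<in>UNIV. \<kappa>' j l (a l))"
    unfolding sum_distrib_left[symmetric] by (subst sum.swap) simp
  also have "\<dots> = 2 ^ s * (\<Sum>j\<in>UNIV. \<Prod>l\<in>UNIV. \<Sum>a<2 ^ M s. \<kappa>' j l a)"
    by (subst sum_box_prod) auto
  also have "\<dots> \<le> 2 ^ s * (\<Sum>j\<in>(UNIV :: 'd set).
      \<Prod>l\<in>UNIV. 2 * (if l = j then 2 ^ k / 2 ^ M s else 1))"
    using factor by (intro mult_left_mono sum_mono prod_mono)
      (auto simp: nonneg intro!: sum_nonneg)
  also have "\<dots> = 2 ^ s * (CARD('d) * (2 ^ CARD('d) * (2 ^ k / 2 ^ M s)))"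
    by (simp add: prod.distrib prod.delta)
  finally show ?thesis .
qed

text \<open>Let \<open>s\<close> be the last stage whose block starts at or below \<open>N\<close>
  in every coordinate. Earlier blocks are complete and add up with 1 to
  \<open>riesz s g = 0\<close>, later blocks are absent, and block \<open>s\<close> is
  small.\<close>

lemma conv_rect_qcoeff:
  assumes "g \<notin> Fpi p"
  shows "conv_rect (qcoeff (tauE (Fpi p))) g 0"
  unfolding conv_rect_def
proof (intro allI impI)
  fix e :: real assume "e > 0"
  obtain s0 where s0: "chi s0 g = -1"
    using assms chi_sign unfolding mem_Fpi by blast
  \<comment> \<open>The number of bits that stage \<open>s0\<close> reads.\<close>
  define k where "k = 2 * M s0 + 1"
  define C where "C = real CARD('d) * (2 ^ CARD('d) * 2 ^ k)"
  have "C > 0" by (simp add: C_def)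
  obtain n where n: "(1 / 2) ^ n < e / C"
    using real_arch_pow_inv[of "e / C" "1 / 2"] \<open>e > 0\<close> \<open>C > 0\<close> by auto
  \<comment> \<open>From \<open>Suc s0\<close> on the Riesz product vanishes at \<open>g\<close>;
    from \<open>n\<close> on the bound for the cut block is below \<open>e\<close>.\<close>
  define s1 where "s1 = max n (Suc s0)"
  show "\<exists>L. \<forall>N. (\<forall>l. L \<le> N l) \<longrightarrow> \<bar>psum (qcoeff (tauE (Fpi p))) N g - 0\<bar> < e"
  proof (intro exI allI impI)
    fix N :: "'d idx" assume N: "\<forall>l. 2 ^ (2 * M s1) \<le> N l"
    define P where "P = (\<lambda>s. \<exists>l. N l < 2 ^ (2 * M s))"
    obtain B where B: "\<And>l. N l < 2 ^ (2 * M B)"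
      using ex_less_pow_M[of N] by blast
    have P_mono: "P t" if "P s" "s \<le> t" for s t
    proof -
      have "(2::nat) ^ (2 * M s) \<le> 2 ^ (2 * M t)"
        using M_mono[OF that(2)] by (intro power_increasing) auto
      then show ?thesis
        using that(1) unfolding P_def by (meson less_le_trans)
    qed
    have "P B" using B by (simp add: P_def)
    moreover have "\<not> P s1" using N by (simp add: P_def not_less)
    ultimately obtain s where s: "\<not> P s" "P (Suc s)" "s1 \<le> s"
    proof -
      assume *: "\<And>s. \<not> P s \<Longrightarrow> P (Suc s) \<Longrightarrow> s1 \<le> s \<Longrightarrow> thesis"
      have Least: "P (LEAST s. P s)" using \<open>P B\<close> by (rule LeastI)
      then have "s1 < (LEAST s. P s)"
        using \<open>\<not> P s1\<close> P_mono by (meson not_less)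
      then obtain s where "(LEAST s. P s) = Suc s" "s1 \<le> s"
        by (metis less_imp_Suc_add le_add1)
      then show thesis
        using * Least not_less_Least[of s P] by auto
    qed
    have Ns: "2 ^ (2 * M s) \<le> N l" for l
      using s(1) by (simp add: P_def not_less)
    have "s0 < s" using s(3) by (simp add: s1_def)
    have low: "block_psum t N g = riesz t g * chi t g" if "t < s" for t
    proof (rule block_psum_full)
      fix l
      have "(2::nat) ^ (2 * M t + 1) \<le> 2 ^ (2 * M s)"
        using M_less[OF that] by (intro power_increasing) auto
      then show "2 ^ (2 * M t + 1) \<le> N l"
        using Ns[of l] by simp
    qed
    have high: "block_psum (Suc s + i) N g = 0" for i
    proof -
      have "P (Suc s + i)" using P_mono[OF s(2)] by simp
      then obtain l where "N l < 2 ^ (2 * M (Suc s + i))"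
        unfolding P_def by blast
      then show ?thesis
        by (intro block_psum_zero less_imp_le)
    qed
    have "psum (qcoeff (tauE (Fpi p))) N g = 1 + (\<Sum>t<Suc s + B. block_psum t N g)"
    proof (rule psum_qcoeff)
      fix l
      have "(1::nat) \<le> 2 ^ (2 * M s)" by simp
      then show "1 \<le> N l" using Ns[of l] by (rule order_trans)
      have "(2::nat) ^ (2 * M B) \<le> 2 ^ (2 * M (Suc s + B))"
        using M_mono[of B "Suc s + B"] by (intro power_increasing) auto
      then show "N l \<le> 2 ^ (2 * M (Suc s + B))"
        using B[of l] by simp
    qed
    also have "\<dots> = 1 + (\<Sum>t<s. riesz t g * chi t g) + block_psum s N g"
      unfolding sum_lessThan_add using high low by simp
    also have "\<dots> = riesz s g + block_psum s N g"
      by (simp only: riesz_expand[of s g])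
    also have "riesz s g = 0"
      unfolding riesz_def using \<open>s0 < s\<close> s0 by (intro prod_zero) (auto intro!: bexI[of _ s0])
    finally have psum: "psum (qcoeff (tauE (Fpi p))) N g = block_psum s N g" by simp
    have "\<bar>block_psum s N g\<bar> \<le> 2 ^ s * (CARD('d) * (2 ^ CARD('d) * (2 ^ k / 2 ^ M s)))"
    proof (rule abs_block_psum_le)
      show k: "k \<le> M s" using M_less[OF \<open>s0 < s\<close>] by (simp add: k_def)
      fix a assume "a \<in> box (M s)" and nz: "riesz s (pt (M s) a) \<noteq> 0"
      \<comment> \<open>A cube agreeing with \<open>g\<close> in the first \<open>k\<close> bits
        violates stage \<open>s0\<close> as well and has density 0.\<close>
      show "\<exists>l. \<exists>i<k. pt1 (M s) (a l) i \<noteq> g l i"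
      proof (rule ccontr)
        assume "\<not> ?thesis"
        then have "chi s0 (pt (M s) a) = chi s0 g"
          by (intro chi_cong) (auto simp: k_def pt_def)
        then have "riesz s (pt (M s) a) = 0"
          unfolding riesz_def using \<open>s0 < s\<close> s0 by (intro prod_zero) (auto intro!: bexI[of _ s0])
        then show False using nz by simp
      qed
    qed
    also have "\<dots> = C * (2 ^ s / 2 ^ M s)"
      by (simp add: C_def)
    also have "\<dots> \<le> C * (1 / 2) ^ n"
    proof -
      \<comment> \<open>Since \<open>s + n \<le> 2 * s \<le> M s\<close>, the growth of
        \<open>M\<close> beats the bound \<open>2 ^ s\<close> of the Riesz product.\<close>
      have "n \<le> s" using s(3) by (simp add: s1_def)
      then have "(2::real) ^ (s + n) \<le> 2 ^ M s"
        using M_ge[of s] by (intro power_increasing) auto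
      then show ?thesis
        using \<open>C > 0\<close> by (simp add: power_add field_simps)
    qed
    also have "\<dots> < e"
      using n \<open>C > 0\<close> by (simp add: field_simps)
    finally show "\<bar>psum (qcoeff (tauE (Fpi p))) N g - 0\<bar> < e"
      by (simp add: psum)
  qed
qed

text \<open>With \<open>s = 0\<close> no block contributes, and the coefficient is the total mass
  1.\<close>

lemma qcoeff_0: "qcoeff (tauE (Fpi p)) (\<lambda>_. 0) \<noteq> 0"
  using qcoeff_eq_sum_block_coeff[of "\<lambda>_. 0" 0] by simp

end

subsection \<open>Repeated convergence\<close>

text \<open>Coordinates in \<open>js\<close> are summed, all others stay as in \<open>n\<close>.
  Every series in the nest has zero terms from index \<open>B\<close> on, so the nest collapses to
  one finite sum.\<close>

lemma rep_conv_finite_support: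
  fixes a :: "'d::finite idx \<Rightarrow> real"
  assumes "distinct js"
    and "\<And>n'. (\<And>l. l \<notin> set js \<Longrightarrow> n' l = n l) \<Longrightarrow> a n' \<noteq> 0 \<Longrightarrow> \<forall>l\<in>set js. n' l < B"
  shows "rep_conv a g js n
    (\<Sum>n' | \<forall>l. n' l \<in> (if l \<in> set js then {..<B} else {n l}). a n' * walsh n' g)"
  using assms
proof (induction js arbitrary: n)
  case Nil
  have "{n'. \<forall>l. n' l = n l} = {n}" by auto
  then show ?case by simp
next
  case (Cons j js)
  define box' where "box' = (\<lambda>js (n :: 'd idx). {n'. \<forall>l. n' l \<in> (if l \<in> set js then {..<B} else {n l})})"
  have fin: "finite (box' js n)" for js n
    unfolding box'_def by (rule finite_box) simp
  define f where "f = (\<lambda>k. \<Sum>n'\<in>box' js (n(j := k)). a n' * walsh n' g)"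
  have j: "j \<notin> set js" using Cons.prems(1) by simp
  have rep: "rep_conv a g js (n(j := k)) (f k)" for k
    unfolding f_def box'_def
  proof (rule Cons.IH)
    fix n' assume *: "\<And>l. l \<notin> set js \<Longrightarrow> n' l = (n(j := k)) l" "a n' \<noteq> 0"
    have "\<forall>l\<in>set (j # js). n' l < B"
      by (rule Cons.prems(2)) (use * in auto)
    then show "\<forall>l\<in>set js. n' l < B" by simp
  qed (use Cons.prems in simp)
  have "f k = 0" if "k \<notin> {..<B}" for k
    unfolding f_def
  proof (rule sum.neutral, rule ballI)
    fix n' assume n': "n' \<in> box' js (n(j := k))"
    have n'_eq: "n' l = (n(j := k)) l" if "l \<notin> set js" for l
      using n' that unfolding box'_def by (auto split: if_splits dest: spec[of _ l])
    have "a n' = 0"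
    proof (rule ccontr)
      assume "a n' \<noteq> 0"
      then have "\<forall>l\<in>set (j # js). n' l < B"
        by (intro Cons.prems(2)) (use n'_eq in auto)
      then show False using n'_eq[OF j] that by simp
    qed
    then show "a n' * walsh n' g = 0" by simp
  qed
  then have "f sums (\<Sum>k<B. f k)"
    by (intro sums_finite) auto
  also have "(\<Sum>k<B. f k) = (\<Sum>n'\<in>box' (j # js) n. a n' * walsh n' g)"
  proof -
    have set: "box' js (n(j := k)) = {n' \<in> box' (j # js) n. n' j = k}" if "k < B" for k
      using j that unfolding box'_def
      by (auto split: if_splits)
    have img: "(\<lambda>n'. n' j) ` box' (j # js) n \<subseteq> {..<B}"
      by (auto simp: box'_def dest: spec[of _ j])
    show ?thesis
      unfolding f_def using sum.group[OF fin _ img] by (simp add: set)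
  qed
  finally show ?case
    using rep unfolding rep_conv.simps box'_def by blast
qed

text \<open>Once the outermost index is fixed, \<open>diag\<close> bounds all others, so the inner
  sums are finite and the outer partial sums are rectangular ones with sides \<open>K\<close> and
  \<open>2 * K\<close>.\<close>

lemma conv_rep_if_conv_rect:
  assumes rect: "conv_rect a g S"
    and diag: "\<And>n l l'. a n \<noteq> 0 \<Longrightarrow> n l \<le> 2 * n l'"
    and js: "distinct js" "set js = (UNIV :: 'd::finite set)"
  shows "conv_rep js a g S"
proof -
  obtain j js' where js': "js = j # js'"
    using js(2) by (cases js) auto
  have js'_set: "l \<in> set js' \<longleftrightarrow> l \<noteq> j" for l
    using js by (auto simp: js')
  \<comment> \<open>The side \<open>2 * k + 1\<close> comes from \<open>n l \<le> 2 * n j\<close>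
    with \<open>n j = k\<close>.\<close>
  define box' where "box' = (\<lambda>k. {n :: 'd idx. \<forall>l. n l \<in> (if l \<in> set js' then {..<2 * k + 1} else {((\<lambda>_. 0)(j := k)) l})})"
  define f where "f = (\<lambda>k. \<Sum>n\<in>box' k. a n * walsh n g)"
  have box': "n \<in> box' k \<longleftrightarrow> n j = k \<and> (\<forall>l. l \<noteq> j \<longrightarrow> n l \<le> 2 * k)" for n k
    unfolding box'_def by (auto simp: js'_set less_Suc_eq_le)
  have rep: "rep_conv a g js' ((\<lambda>_. 0)(j := k)) (f k)" for k
    unfolding f_def box'_def
  proof (rule rep_conv_finite_support)
    fix n assume "\<And>l. l \<notin> set js' \<Longrightarrow> n l = ((\<lambda>_. 0)(j := k)) l" "a n \<noteq> 0"
    then show "\<forall>l\<in>set js'. n l < 2 * k + 1"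
      using diag[of n _ j] js'_set by (fastforce simp: less_Suc_eq_le)
  qed (use js in \<open>simp add: js'\<close>)
  have partial: "(\<Sum>k<K. f k) = psum a (\<lambda>l. if l = j then K else 2 * K) g" for K
  proof -
    let ?R = "{n. \<forall>l. n l \<in> {..<if l = j then K else 2 * K}}"
    have fin: "finite ?R" by (rule finite_box) simp
    have img: "(\<lambda>n. n j) ` ?R \<subseteq> {..<K}" by (auto dest: spec[of _ j])
    \<comment> \<open>The box of \<open>k\<close> is enlarged to a slice of the rectangle; by
      \<open>diag\<close> all added coefficients are 0.\<close>
    have "f k = (\<Sum>n\<in>{n \<in> ?R. n j = k}. a n * walsh n g)" if "k < K" for k
      unfolding f_def
    proof (rule sum.mono_neutral_left)
      show "finite {n \<in> ?R. n j = k}" using fin by simp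
      show "box' k \<subseteq> {n \<in> ?R. n j = k}"
        using that by (fastforce simp: box')
      show "\<forall>n\<in>{n \<in> ?R. n j = k} - box' k. a n * walsh n g = 0"
      proof
        fix n assume "n \<in> {n \<in> ?R. n j = k} - box' k"
        then obtain l where "\<not> n l \<le> 2 * n j"
          by (auto simp: box')
        then have "a n = 0" using diag by blast
        then show "a n * walsh n g = 0" by simp
      qed
    qed
    then have "(\<Sum>k<K. f k) = (\<Sum>n\<in>?R. a n * walsh n g)"
      using sum.group[OF fin _ img, of "\<lambda>n. a n * walsh n g"] by simp
    then show ?thesis by (simp add: psum_def)
  qed
  have "f sums S"
    unfolding sums_def LIMSEQ_iff real_norm_def partial
  proof (intro allI impI)
    fix e :: real assume "0 < e"
    then obtain L where "\<And>N. (\<forall>l. L \<le> N l) \<Longrightarrow> \<bar>psum a N g - S\<bar> < e"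
      using rect unfolding conv_rect_def by blast
    then show "\<exists>L. \<forall>K\<ge>L. \<bar>psum a (\<lambda>l. if l = j then K else 2 * K) g - S\<bar> < e"
      by (intro exI[of _ L]) auto
  qed
  then show ?thesis
    unfolding conv_rep_def js' using rep by auto
qed

lemma conv_cube_if_conv_rect:
  assumes "conv_rect a g S"
  shows "conv_cube a g S"
  unfolding conv_cube_def LIMSEQ_iff real_norm_def
proof (intro allI impI)
  fix e :: real assume "0 < e"
  then obtain L where "\<And>N. (\<forall>l. L \<le> N l) \<Longrightarrow> \<bar>psum a N g - S\<bar> < e"
    using assms unfolding conv_rect_def by blast
  then show "\<exists>L. \<forall>K\<ge>L. \<bar>psum a (\<lambda>_. K) g - S\<bar> < e"
    by (intro exI[of _ L]) auto
qed

theorem theorem2: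
  fixes p :: "nat \<Rightarrow> 'd::finite \<Rightarrow> nat \<Rightarrow> nat"
  assumes "card (UNIV :: 'd set) \<ge> 2"
    and "\<forall>s\<ge>1. \<forall>l. bij_betw (p s l) {..<2 ^ mseq s} {..<2 ^ mseq s}"
  shows "M_set conv_rect (Fpi p) \<and> M_set conv_cube (Fpi p) \<and>
         (\<forall>js. distinct js \<and> set js = UNIV \<longrightarrow> M_set (conv_rep js) (Fpi p)) \<and>
         null_series conv_rect (qcoeff (tauE (Fpi p))) (Fpi p) \<and>
         null_series conv_cube (qcoeff (tauE (Fpi p))) (Fpi p) \<and>
         (\<forall>js. distinct js \<and> set js = UNIV \<longrightarrow>
            null_series (conv_rep js) (qcoeff (tauE (Fpi p))) (Fpi p))"
proof -
  interpret riesz_set p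
    by unfold_locales (use assms(2) in blast)
  have "null_series conv_rect (qcoeff (tauE (Fpi p))) (Fpi p)"
    using qcoeff_0 conv_rect_qcoeff by (auto simp: null_series_def)
  moreover have "null_series conv_cube (qcoeff (tauE (Fpi p))) (Fpi p)"
    using qcoeff_0 conv_rect_qcoeff by (auto simp: null_series_def intro!: conv_cube_if_conv_rect)
  moreover have "null_series (conv_rep js) (qcoeff (tauE (Fpi p))) (Fpi p)"
    if "distinct js" "set js = UNIV" for js
    using qcoeff_0 conv_rect_qcoeff that
    by (auto simp: null_series_def intro!: conv_rep_if_conv_rect qcoeff_diagonal)
  ultimately show ?thesis
    unfolding M_set_def by blast
qed

end
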